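(* On an $n$-manifold, for a special statistical structure $(\nabla,g)$ with stress-energy tensor $\mathcal T_{ij}$ and scalar curvature $\mathit s$ there holds $$2(n-2)\,d\mathit s_i=2n\,\mathcal L^{abc}R_{i(abc)}=n\,\mathrm{div}(\mathcal T)_i.$$ For a naive Einstein special statistical structure on a manifold of dimension $n\ge3$ the following are equivalent: (1) It is Einstein. (2) Its stress-energy tensor is divergence free. (3) The metric $g$ satisfies the Einstein field equations $\mathcal G_{ij}=\frac14\mathcal T_{ij}$.
   Context: Manifolds are smooth and connected; $[\,]$, $(\,)$ on indices denote antisymmetrization/symmetrization; indices are raised and lowered with $g$, which may have any signature. A special statistical structure is a pair $(\nabla,g)$ of a torsion-free affine connection and a pseudo-Riemannian metric with $\nabla_{[i}g_{j]k}=0$ and $g^{pq}\nabla_ig_{pq}=0$. Its cubic form is $\mathcal L_{ijk}=\nabla_ig_{jk}$ and its conjugate is $(\bar\nabla,g)$ with $\bar\nabla=\nabla+g^{kp}\nabla_ig_{jp}$. Curvature: $2\nabla_{[i}\nabla_{j]}X^k=R_{ijp}{}^kX^p$, $R_{ijkl}=R_{ijk}{}^pg_{pl}$, Ricci tensor $R_{ij}=R_{pij}{}^p$, scalar curvature $\mathit s=g^{pq}R_{pq}$; $\bar R_{ij}$ is the Ricci tensor of $\bar\nabla$. The structure is naive Einstein if $R_{(ij)}=\frac{\mathit s}ng_{ij}=\bar R_{(ij)}$, and Einstein if moreover $\mathit s$ is constant ($d\mathit s_i=0$). The stress-energy tensor is $\mathcal T_{ij}=\mathcal L_{ip}{}^q\mathcal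 L_{jq}{}^p-\frac12|\mathcal L|^2g_{ij}$ with $|\mathcal L|^2=\mathcal L^{ijk}\mathcal L_{ijk}$; its divergence is $\mathrm{div}(\mathcal T)_i=g^{pq}D_p\mathcal T_{iq}$, where $D$ is the Levi-Civita connection of $g$. $\mathcal G_{ij}$ is the Einstein tensor of $g$: the Ricci tensor of $D$ minus half of its scalar curvature times $g_{ij}$.
   Formalization: The first display is stated for naive Einstein structures (it fails for ∇=D with s non-constant); (3) reads G+Λg=T/4 for some constant Λ (the round sphere violates (1)⇒(3) as printed), and G=T/4 is shown equivalent to Einstein with s=0. *)

theory Defs
  imports "HOL-Analysis.Analysis"
begin

section \<open>Smooth functions on open subsets of Euclidean space\<close>

definition partial_deriv :: "'n \<Rightarrow> (real^'n::finite \<Rightarrow> real) \<Rightarrow> real^'n \<Rightarrow> real" where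
  "partial_deriv i f x = frechet_derivative f (at x) (axis i 1)"

primrec Ck_on :: "nat \<Rightarrow> (real^'n::finite) set \<Rightarrow> (real^'n \<Rightarrow> real) \<Rightarrow> bool" where
  "Ck_on 0 U f \<longleftrightarrow> continuous_on U f"
| "Ck_on (Suc k) U f \<longleftrightarrow>
     (\<forall>x\<in>U. f differentiable (at x)) \<and> (\<forall>i. Ck_on k U (partial_deriv i f))"

text \<open>Only meaningful for open \<open>U\<close>.\<close>

definition smooth_on :: "(real^'n::finite) set \<Rightarrow> (real^'n \<Rightarrow> real) \<Rightarrow> bool" where
  "smooth_on U f \<longleftrightarrow> (\<forall>k. Ck_on k U f)"


section \<open>Smooth manifolds\<close>

text \<open>A chart is a pair of a domain and a coordinate map. The dimension \<open>n\<close> is \<open>CARD('n)\<close>.\<close>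

type_synonym ('a, 'n) chart = "'a set \<times> ('a \<Rightarrow> real^'n)"

abbreviation chart_image :: "('a, 'n::finite) chart \<Rightarrow> (real^'n) set" where
  "chart_image c \<equiv> snd c ` fst c"

definition is_chart :: "'a topology \<Rightarrow> ('a, 'n::finite) chart \<Rightarrow> bool" where
  "is_chart X c \<longleftrightarrow> openin X (fst c) \<and> open (chart_image c) \<and>
     homeomorphic_map (subtopology X (fst c)) (top_of_set (chart_image c)) (snd c)"

definition coord_expr :: "('a, 'n::finite) chart \<Rightarrow> ('a \<Rightarrow> real) \<Rightarrow> real^'n \<Rightarrow> real" where
  "coord_expr c f = f \<circ> inv_into (fst c) (snd c)"

definition chart_partial :: "('a, 'n::finite) chart \<Rightarrow> 'n \<Rightarrow> ('a \<Rightarrow> real) \<Rightarrow> 'a \<Rightarrow> real" where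
  "chart_partial c i f p = partial_deriv i (coord_expr c f) (snd c p)"

text \<open>The atlas need not be maximal.\<close>

definition smooth_manifold :: "'a topology \<Rightarrow> ('a, 'n::finite) chart set \<Rightarrow> bool" where
  "smooth_manifold X A \<longleftrightarrow>
     Hausdorff_space X \<and> second_countable X \<and> connected_space X \<and>
     (\<forall>c\<in>A. is_chart X c) \<and> (\<Union>c\<in>A. fst c) = topspace X \<and>
     (\<forall>c\<in>A. \<forall>d\<in>A. \<forall>m. smooth_on (snd c ` (fst c \<inter> fst d)) (coord_expr c (\<lambda>p. snd d p $ m)))"

text \<open>\<open>jacobian c d p i m\<close> is \<open>\<partial>y\<^sup>m/\<partial>x\<^sup>i\<close> at \<open>p\<close>, for \<open>x\<close> the coordinates of \<open>c\<close> and \<open>y\<close> those of \<open>d\<close>.\<close>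

definition jacobian ::
  "('a, 'n::finite) chart \<Rightarrow> ('a, 'n) chart \<Rightarrow> 'a \<Rightarrow> 'n \<Rightarrow> 'n \<Rightarrow> real" where
  "jacobian c d p i m = chart_partial c i (\<lambda>q. snd d q $ m) p"


section \<open>Metrics and affine connections\<close>

text \<open>Geometric objects are given by their components in every chart of the atlas, as functions
  on the domain of the chart, subject to the appropriate transformation law on overlaps.
  For a covariant tensor \<open>T\<close>, \<open>T c p i j\<close> is the component \<open>T\<^sub>i\<^sub>j\<close> at \<open>p\<close> in the chart \<open>c\<close>.\<close>

type_synonym ('a, 'n) comp1 = "('a, 'n) chart \<Rightarrow> 'a \<Rightarrow> 'n \<Rightarrow> real"
type_synonym ('a, 'n) comp2 = "('a, 'n) chart \<Rightarrow> 'a \<Rightarrow> 'n \<Rightarrow> 'n \<Rightarrow> real"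
type_synonym ('a, 'n) comp3 = "('a, 'n) chart \<Rightarrow> 'a \<Rightarrow> 'n \<Rightarrow> 'n \<Rightarrow> 'n \<Rightarrow> real"
type_synonym ('a, 'n) comp4 = "('a, 'n) chart \<Rightarrow> 'a \<Rightarrow> 'n \<Rightarrow> 'n \<Rightarrow> 'n \<Rightarrow> 'n \<Rightarrow> real"

definition pseudo_riemannian_metric ::
  "('a, 'n::finite) chart set \<Rightarrow> ('a, 'n) comp2 \<Rightarrow> bool" where
  "pseudo_riemannian_metric A g \<longleftrightarrow>
     (\<forall>c\<in>A. \<forall>i j. smooth_on (chart_image c) (coord_expr c (\<lambda>p. g c p i j))) \<and>
     (\<forall>c\<in>A. \<forall>p\<in>fst c. (\<forall>i j. g c p i j = g c p j i) \<and> invertible (\<chi> i j. g c p i j)) \<and>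
     (\<forall>c\<in>A. \<forall>d\<in>A. \<forall>p\<in>fst c \<inter> fst d. \<forall>i j.
        g c p i j = (\<Sum>a\<in>UNIV. \<Sum>b\<in>UNIV. jacobian c d p i a * jacobian c d p j b * g d p a b))"

text \<open>The components \<open>g\<^sup>i\<^sup>j\<close>.\<close>

definition ginv :: "('a, 'n::finite) comp2 \<Rightarrow> ('a, 'n) comp2" where
  "ginv g c p i j = matrix_inv (\<chi> a b. g c p a b) $ i $ j"

text \<open>An affine connection \<open>\<nabla>\<close> is given by its Christoffel symbols:
  \<open>\<Gamma> c p i j k\<close> is the coefficient of \<open>\<partial>\<^sub>k\<close> in \<open>\<nabla>\<^sub>i\<partial>\<^sub>j\<close>. The transformation law expresses
  that \<open>\<nabla>\<close> is the same operator in the two charts.\<close>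

definition affine_connection ::
  "('a, 'n::finite) chart set \<Rightarrow> ('a, 'n) comp3 \<Rightarrow> bool" where
  "affine_connection A \<Gamma> \<longleftrightarrow>
     (\<forall>c\<in>A. \<forall>i j k. smooth_on (chart_image c) (coord_expr c (\<lambda>p. \<Gamma> c p i j k))) \<and>
     (\<forall>c\<in>A. \<forall>d\<in>A. \<forall>p\<in>fst c \<inter> fst d. \<forall>i j m.
        (\<Sum>k\<in>UNIV. \<Gamma> c p i j k * jacobian c d p k m) =
        chart_partial c i (\<lambda>q. jacobian c d q j m) p +
        (\<Sum>a\<in>UNIV. \<Sum>b\<in>UNIV. jacobian c d p i a * jacobian c d p j b * \<Gamma> d p a b m))"

definition torsion_free :: "('a, 'n::finite) chart set \<Rightarrow> ('a, 'n) comp3 \<Rightarrow> bool" where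
  "torsion_free A \<Gamma> \<longleftrightarrow> (\<forall>c\<in>A. \<forall>p\<in>fst c. \<forall>i j k. \<Gamma> c p i j k = \<Gamma> c p j i k)"

text \<open>\<open>cov_deriv \<Gamma> T c p i j k\<close> is \<open>\<nabla>\<^sub>iT\<^sub>j\<^sub>k\<close>.\<close>

definition cov_deriv :: "('a, 'n::finite) comp3 \<Rightarrow> ('a, 'n) comp2 \<Rightarrow> ('a, 'n) comp3" where
  "cov_deriv \<Gamma> T c p i j k = chart_partial c i (\<lambda>q. T c q j k) p
     - (\<Sum>a\<in>UNIV. \<Gamma> c p i j a * T c p a k) - (\<Sum>a\<in>UNIV. \<Gamma> c p i k a * T c p j a)"

definition levi_civita ::
  "('a, 'n::finite) chart set \<Rightarrow> ('a, 'n) comp2 \<Rightarrow> ('a, 'n) comp3 \<Rightarrow> bool" where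
  "levi_civita A g D \<longleftrightarrow> affine_connection A D \<and> torsion_free A D \<and>
     (\<forall>c\<in>A. \<forall>p\<in>fst c. \<forall>i j k. cov_deriv D g c p i j k = 0)"


section \<open>Curvature\<close>

text \<open>\<open>curvature \<Gamma> c p i j k l\<close> is \<open>R\<^sub>i\<^sub>j\<^sub>k\<^sup>l\<close>, for torsion-free \<open>\<nabla>\<close> the coefficient of \<open>X\<^sup>k\<close> in
  \<open>\<nabla>\<^sub>i\<nabla>\<^sub>jX\<^sup>l - \<nabla>\<^sub>j\<nabla>\<^sub>iX\<^sup>l\<close>, where \<open>\<nabla>\<^sub>iX\<^sup>l = \<partial>\<^sub>iX\<^sup>l + \<Gamma>\<^sub>i\<^sub>k\<^sup>lX\<^sup>k\<close>.\<close>

definition curvature :: "('a, 'n::finite) comp3 \<Rightarrow> ('a, 'n) comp4" where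
  "curvature \<Gamma> c p i j k l =
     chart_partial c i (\<lambda>q. \<Gamma> c q j k l) p - chart_partial c j (\<lambda>q. \<Gamma> c q i k l) p
     + (\<Sum>m\<in>UNIV. \<Gamma> c p i m l * \<Gamma> c p j k m) - (\<Sum>m\<in>UNIV. \<Gamma> c p j m l * \<Gamma> c p i k m)"

text \<open>\<open>R\<^sub>i\<^sub>j\<^sub>k\<^sub>l\<close>, with the last index lowered.\<close>

definition curvature_low ::
  "('a, 'n::finite) comp2 \<Rightarrow> ('a, 'n) comp3 \<Rightarrow> ('a, 'n) comp4" where
  "curvature_low g \<Gamma> c p i j k l = (\<Sum>m\<in>UNIV. curvature \<Gamma> c p i j k m * g c p m l)"

text \<open>The trace is over the first and the last index: \<open>R\<^sub>i\<^sub>j = R\<^sub>m\<^sub>i\<^sub>j\<^sup>m\<close>.\<close>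

definition ricci :: "('a, 'n::finite) comp3 \<Rightarrow> ('a, 'n) comp2" where
  "ricci \<Gamma> c p i j = (\<Sum>m\<in>UNIV. curvature \<Gamma> c p m i j m)"

definition scalar_curvature ::
  "('a, 'n::finite) comp2 \<Rightarrow> ('a, 'n) comp3 \<Rightarrow> ('a, 'n) chart \<Rightarrow> 'a \<Rightarrow> real" where
  "scalar_curvature g \<Gamma> c p = (\<Sum>i\<in>UNIV. \<Sum>j\<in>UNIV. ginv g c p i j * ricci \<Gamma> c p i j)"

definition d_scalar ::
  "('a, 'n::finite) comp2 \<Rightarrow> ('a, 'n) comp3 \<Rightarrow> ('a, 'n) comp1" where
  "d_scalar g \<Gamma> c p i = chart_partial c i (scalar_curvature g \<Gamma> c) p"

definition einstein_tensor ::
  "('a, 'n::finite) comp2 \<Rightarrow> ('a, 'n) comp3 \<Rightarrow> ('a, 'n) comp2" where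
  "einstein_tensor g D c p i j = ricci D c p i j - (1/2) * scalar_curvature g D c p * g c p i j"


section \<open>Special statistical structures\<close>

definition special_statistical ::
  "('a, 'n::finite) chart set \<Rightarrow> ('a, 'n) comp3 \<Rightarrow> ('a, 'n) comp2 \<Rightarrow> bool" where
  "special_statistical A \<Gamma> g \<longleftrightarrow>
     affine_connection A \<Gamma> \<and> torsion_free A \<Gamma> \<and> pseudo_riemannian_metric A g \<and>
     (\<forall>c\<in>A. \<forall>p\<in>fst c. \<forall>i j k.
        (1/2) * (cov_deriv \<Gamma> g c p i j k - cov_deriv \<Gamma> g c p j i k) = 0) \<and>
     (\<forall>c\<in>A. \<forall>p\<in>fst c. \<forall>i.
        (\<Sum>a\<in>UNIV. \<Sum>b\<in>UNIV. ginv g c p a b * cov_deriv \<Gamma> g c p i a b) = 0)"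

definition cubic_form ::
  "('a, 'n::finite) comp3 \<Rightarrow> ('a, 'n) comp2 \<Rightarrow> ('a, 'n) comp3" where
  "cubic_form \<Gamma> g = cov_deriv \<Gamma> g"

definition conjugate ::
  "('a, 'n::finite) comp3 \<Rightarrow> ('a, 'n) comp2 \<Rightarrow> ('a, 'n) comp3" where
  "conjugate \<Gamma> g c p i j k =
     \<Gamma> c p i j k + (\<Sum>a\<in>UNIV. ginv g c p k a * cov_deriv \<Gamma> g c p i j a)"

definition naive_einstein ::
  "('a, 'n::finite) chart set \<Rightarrow> ('a, 'n) comp3 \<Rightarrow> ('a, 'n) comp2 \<Rightarrow> bool" where
  "naive_einstein A \<Gamma> g \<longleftrightarrow> (\<forall>c\<in>A. \<forall>p\<in>fst c. \<forall>i j.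
     (1/2) * (ricci \<Gamma> c p i j + ricci \<Gamma> c p j i)
       = scalar_curvature g \<Gamma> c p / real CARD('n) * g c p i j \<and>
     (1/2) * (ricci (conjugate \<Gamma> g) c p i j + ricci (conjugate \<Gamma> g) c p j i)
       = scalar_curvature g \<Gamma> c p / real CARD('n) * g c p i j)"

definition einstein ::
  "('a, 'n::finite) chart set \<Rightarrow> ('a, 'n) comp3 \<Rightarrow> ('a, 'n) comp2 \<Rightarrow> bool" where
  "einstein A \<Gamma> g \<longleftrightarrow>
     naive_einstein A \<Gamma> g \<and> (\<forall>c\<in>A. \<forall>p\<in>fst c. \<forall>i. d_scalar g \<Gamma> c p i = 0)"


section \<open>The stress-energy tensor\<close>

text \<open>The components \<open>L\<^sub>i\<^sub>j\<^sup>k\<close>.\<close>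

definition cubic_form_up ::
  "('a, 'n::finite) comp3 \<Rightarrow> ('a, 'n) comp2 \<Rightarrow> ('a, 'n) comp3" where
  "cubic_form_up \<Gamma> g c p i j k = (\<Sum>a\<in>UNIV. cubic_form \<Gamma> g c p i j a * ginv g c p a k)"

text \<open>The components \<open>L\<^sup>i\<^sup>j\<^sup>k\<close>.\<close>

definition cubic_form_upup ::
  "('a, 'n::finite) comp3 \<Rightarrow> ('a, 'n) comp2 \<Rightarrow> ('a, 'n) comp3" where
  "cubic_form_upup \<Gamma> g c p i j k = (\<Sum>a\<in>UNIV. \<Sum>b\<in>UNIV. \<Sum>e\<in>UNIV.
     ginv g c p i a * ginv g c p j b * ginv g c p k e * cubic_form \<Gamma> g c p a b e)"

definition cubic_form_sqnorm ::
  "('a, 'n::finite) comp3 \<Rightarrow> ('a, 'n) comp2 \<Rightarrow> ('a, 'n) chart \<Rightarrow> 'a \<Rightarrow> real" where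
  "cubic_form_sqnorm \<Gamma> g c p = (\<Sum>i\<in>UNIV. \<Sum>j\<in>UNIV. \<Sum>k\<in>UNIV.
     cubic_form_upup \<Gamma> g c p i j k * cubic_form \<Gamma> g c p i j k)"

definition stress_energy ::
  "('a, 'n::finite) comp3 \<Rightarrow> ('a, 'n) comp2 \<Rightarrow> ('a, 'n) comp2" where
  "stress_energy \<Gamma> g c p i j =
     (\<Sum>a\<in>UNIV. \<Sum>b\<in>UNIV. cubic_form_up \<Gamma> g c p i a b * cubic_form_up \<Gamma> g c p j b a)
     - (1/2) * cubic_form_sqnorm \<Gamma> g c p * g c p i j"

text \<open>\<open>g\<^sup>a\<^sup>bD\<^sub>aT\<^sub>i\<^sub>b\<close>, where \<open>D\<close> is meant to be the Levi-Civita connection of \<open>g\<close>.\<close>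

definition divergence ::
  "('a, 'n::finite) comp2 \<Rightarrow> ('a, 'n) comp3 \<Rightarrow> ('a, 'n) comp2 \<Rightarrow> ('a, 'n) comp1" where
  "divergence g D T c p i = (\<Sum>a\<in>UNIV. \<Sum>b\<in>UNIV. ginv g c p a b * cov_deriv D T c p a i b)"

definition sym3 :: "('n \<Rightarrow> 'n \<Rightarrow> 'n \<Rightarrow> real) \<Rightarrow> 'n \<Rightarrow> 'n \<Rightarrow> 'n \<Rightarrow> real" where
  "sym3 F a b e = (1/6) * (F a b e + F a e b + F b a e + F b e a + F e a b + F e b a)"

text \<open>The one-form \<open>L\<^sup>a\<^sup>b\<^sup>eR\<^sub>i\<^sub>(\<^sub>a\<^sub>b\<^sub>e\<^sub>)\<close>.\<close>

definition cubic_form_dot_curvature ::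
  "('a, 'n::finite) comp3 \<Rightarrow> ('a, 'n) comp2 \<Rightarrow> ('a, 'n) comp1" where
  "cubic_form_dot_curvature \<Gamma> g c p i = (\<Sum>a\<in>UNIV. \<Sum>b\<in>UNIV. \<Sum>e\<in>UNIV.
     cubic_form_upup \<Gamma> g c p a b e * sym3 (curvature_low g \<Gamma> c p i) a b e)"

text \<open>The Einstein field equations with stress-energy tensor \<open>(1/4) T\<close> and cosmological
  constant \<open>\<Lambda>\<close>.\<close>

definition einstein_field_equations ::
  "('a, 'n::finite) chart set \<Rightarrow> ('a, 'n) comp2 \<Rightarrow> ('a, 'n) comp3 \<Rightarrow> real \<Rightarrow>
   ('a, 'n) comp2 \<Rightarrow> bool" where
  "einstein_field_equations A g D \<Lambda> T \<longleftrightarrow> (\<forall>c\<in>A. \<forall>p\<in>fst c. \<forall>i j.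
     einstein_tensor g D c p i j + \<Lambda> * g c p i j = (1/4) * T c p i j)"

end

theory Submission
  imports Defs
begin

text \<open>
  Write \<open>L\<close> for the cubic form. Since \<open>\<nabla> = D - L/2\<close> and the conjugate connection is \<open>D + L/2\<close>, the two
  Ricci tensors are \<open>Ric(D) \<mp> div(L)/2 - \<langle>L, L\<rangle>/4\<close>, where \<open>\<langle>L, L\<rangle>\<^sub>i\<^sub>j = tr(L\<^sub>iL\<^sub>j)\<close> for the endomorphisms
  \<open>L\<^sub>i\<close>. Hence naive Einstein means \<open>div(L) = 0\<close> and \<open>Ric(D) = \<langle>L, L\<rangle>/4 + (s/n) g\<close>, which is equivalent to
  \<open>G = T/4 - ((n - 2)/2n) s g\<close>. The contracted Bianchi identity \<open>div(G) = 0\<close> turns this into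
  \<open>n div(T) = 2(n - 2) ds\<close>, and contracting the curvature of \<open>D - L/2\<close> with \<open>L\<close> gives \<open>div(T)/2\<close>, because
  \<open>div(L) = 0\<close> and the terms that are cubic in \<open>L\<close> cancel. That \<open>s\<close> does not depend on the chart, so that
  \<open>ds = 0\<close> makes it constant on the connected manifold, follows from the transformation law of the curvature.
\<close>

section \<open>Partial derivatives\<close>

text \<open>The factor 1/2 in D - L/2 is Koszul's: the lowered difference of two torsion-free
  connections is symmetric in its first two indices, metric compatibility of D makes its
  symmetrization in the last two reproduce L, and total symmetry of L leaves L/2. Both the given
  connection and its conjugate lie in the family D + tL, whose curvature is quadratic in t. The
  values at t = -1/2 and t = 1/2 separate div(L), the odd part, from the even part; the trace
  condition on L removes the other contractions. Within a chart the form index labels matrices, so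
  contractions become traces and most cancellations are cyclicity of the trace or the pairing of
  symmetric with skew matrices. Only one step is global: a cosmological constant is a single number,
  so the vanishing of ds in every chart has to give one value on all charts. The values of s on an
  overlap are compared without transforming the inverse metric: the symmetrized Ricci tensor and g
  are both tensors, and the factor s/n between them is determined since g has a nonzero
  component.\<close>

lemma partial_deriv_has_real_derivative:
  fixes f :: "real^'n::finite \<Rightarrow> real"
  assumes "f differentiable (at (x + a *\<^sub>R axis i 1))"
  shows "((\<lambda>t. f (x + t *\<^sub>R axis i 1)) has_real_derivative partial_deriv i f (x + a *\<^sub>R axis i 1)) (at a)"
proof -
  let ?y = "x + a *\<^sub>R axis i 1"
  have f: "(f has_derivative frechet_derivative f (at ?y)) (at ?y)"
    using assms frechet_derivative_works by blast
  have "((\<lambda>t. x + t *\<^sub>R axis i 1) has_derivative (\<lambda>t. t *\<^sub>R axis i 1)) (at a)"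
    by (auto intro!: derivative_eq_intros)
  from has_derivative_compose[OF this f]
  have "((\<lambda>t. f (x + t *\<^sub>R axis i 1)) has_derivative
      (\<lambda>t. frechet_derivative f (at ?y) (t *\<^sub>R axis i 1))) (at a)" .
  moreover have "(\<lambda>t. frechet_derivative f (at ?y) (t *\<^sub>R axis i 1))
      = (*) (partial_deriv i f ?y)"
    using linear_frechet_derivative[OF assms]
    by (auto simp: partial_deriv_def linear_cmul fun_eq_iff)
  ultimately show ?thesis
    by (simp add: has_field_derivative_def)
qed

lemma frechet_derivative_eq_sum_partial_deriv:
  fixes f :: "real^'n::finite \<Rightarrow> real"
  assumes "f differentiable (at x)"
  shows "frechet_derivative f (at x) v = (\<Sum>i\<in>UNIV. v $ i * partial_deriv i f x)"
proof -
  have lin: "linear (frechet_derivative f (at x))"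
    by (rule linear_frechet_derivative[OF assms])
  have "v = (\<Sum>i\<in>UNIV. v $ i *\<^sub>R axis i 1)"
    using basis_expansion[of v] by (simp add: scalar_mult_eq_scaleR)
  then have "frechet_derivative f (at x) v = frechet_derivative f (at x) (\<Sum>i\<in>UNIV. v $ i *\<^sub>R axis i 1)"
    by simp
  then show ?thesis
    by (simp add: linear_sum[OF lin] linear_cmul[OF lin] partial_deriv_def)
qed

lemma partial_deriv_add:
  assumes "f differentiable (at x)" "g differentiable (at x)"
  shows "partial_deriv i (\<lambda>y. f y + g y) x = partial_deriv i f x + partial_deriv i g x"
proof -
  have "((\<lambda>y. f y + g y) has_derivative (\<lambda>v. frechet_derivative f (at x) v + frechet_derivative g (at x) v)) (at x)"
    using assms frechet_derivative_works has_derivative_add by blast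
  from frechet_derivative_at[OF this, symmetric] show ?thesis by (simp add: partial_deriv_def)
qed

lemma partial_deriv_mult:
  assumes "f differentiable (at x)" "g differentiable (at x)"
  shows "partial_deriv i (\<lambda>y. f y * g y) x = partial_deriv i f x * g x + f x * partial_deriv i g x"
proof -
  have "((\<lambda>y. f y * g y) has_derivative (\<lambda>v. f x * frechet_derivative g (at x) v + frechet_derivative f (at x) v * g x)) (at x)"
    using assms frechet_derivative_works has_derivative_mult by blast
  from frechet_derivative_at[OF this, symmetric] show ?thesis by (simp add: partial_deriv_def)
qed

lemma partial_deriv_const: "partial_deriv i (\<lambda>y. a) x = 0"
  by (simp add: partial_deriv_def)

lemma partial_deriv_cong:
  assumes "open U" "x \<in> U" "\<And>y. y \<in> U \<Longrightarrow> f y = g y"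
  shows "partial_deriv i f x = partial_deriv i g x"
proof -
  have "(f has_derivative F) (at x) \<longleftrightarrow> (g has_derivative F) (at x)" for F
    using assms by (metis has_derivative_transform_within_open)
  then show ?thesis by (simp add: partial_deriv_def frechet_derivative_def)
qed

lemma differentiable_cong_open:
  assumes "open U" "x \<in> U" "\<And>y. y \<in> U \<Longrightarrow> f y = g y" "f differentiable (at x)"
  shows "g differentiable (at x)"
  using assms by (metis differentiable_def has_derivative_transform_within_open)

text \<open>The mean value theorem acts twice: along \<open>axis i 1\<close> on the difference of
  two parallel restrictions of \<open>f\<close>, then along \<open>axis j 1\<close> on
  \<open>partial_deriv i f\<close>. Each displacement has norm at most \<open>t\<close>, whence the
  radius \<open>2 * t\<close>.\<close>

lemma second_difference_eq:
  fixes f :: "real^'n::finite \<Rightarrow> real"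
  assumes "0 < t" and "cball x (2 * t) \<subseteq> U"
    and "\<And>y. y \<in> U \<Longrightarrow> f differentiable (at y)"
    and "\<And>y. y \<in> U \<Longrightarrow> partial_deriv i f differentiable (at y)"
  shows "\<exists>y\<in>cball x (2 * t).
    f (x + t *\<^sub>R axis i 1 + t *\<^sub>R axis j 1) - f (x + t *\<^sub>R axis i 1) - f (x + t *\<^sub>R axis j 1) + f x
      = t\<^sup>2 * partial_deriv j (partial_deriv i f) y"
proof -
  have U: "x + a *\<^sub>R axis i 1 + b *\<^sub>R axis j 1 \<in> cball x (2 * t)" if "\<bar>a\<bar> \<le> t" "\<bar>b\<bar> \<le> t" for a b
  proof -
    have "norm (a *\<^sub>R axis i (1::real) + b *\<^sub>R axis j 1) \<le> norm (a *\<^sub>R axis i (1::real)) + norm (b *\<^sub>R axis j (1::real))"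
      by (rule norm_triangle_ineq)
    also have "\<dots> \<le> 2 * t" using that by simp
    finally show ?thesis by (simp add: dist_norm norm_minus_commute algebra_simps)
  qed
  let ?\<phi> = "\<lambda>a. f (x + t *\<^sub>R axis j 1 + a *\<^sub>R axis i 1) - f (x + a *\<^sub>R axis i 1)"
  let ?\<phi>' = "\<lambda>a. partial_deriv i f (x + t *\<^sub>R axis j 1 + a *\<^sub>R axis i 1) - partial_deriv i f (x + a *\<^sub>R axis i 1)"
  have "(?\<phi> has_real_derivative ?\<phi>' a) (at a)" if "0 \<le> a" "a \<le> t" for a
  proof (rule DERIV_diff)
    have "x + a *\<^sub>R axis i 1 + t *\<^sub>R axis j 1 \<in> U" using U[of a t] that assms(1,2) by auto
    then show "((\<lambda>a. f (x + t *\<^sub>R axis j 1 + a *\<^sub>R axis i 1)) has_real_derivative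
        partial_deriv i f (x + t *\<^sub>R axis j 1 + a *\<^sub>R axis i 1)) (at a)"
      by (intro partial_deriv_has_real_derivative assms(3)) (simp add: algebra_simps)
    have "x + a *\<^sub>R axis i 1 \<in> U" using U[of a 0] that assms(1,2) by auto
    then show "((\<lambda>a. f (x + a *\<^sub>R axis i 1)) has_real_derivative
        partial_deriv i f (x + a *\<^sub>R axis i 1)) (at a)"
      by (intro partial_deriv_has_real_derivative assms(3))
  qed
  from MVT2[OF assms(1) this] obtain \<xi> where \<xi>: "0 < \<xi>" "\<xi> < t" "?\<phi> t - ?\<phi> 0 = t * ?\<phi>' \<xi>"
    by auto
  let ?z = "x + \<xi> *\<^sub>R axis i 1"
  have "((\<lambda>b. partial_deriv i f (?z + b *\<^sub>R axis j 1)) has_real_derivative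
       partial_deriv j (partial_deriv i f) (?z + b *\<^sub>R axis j 1)) (at b)" if "0 \<le> b" "b \<le> t" for b
    using U[of \<xi> b] that \<xi> assms(2) by (intro partial_deriv_has_real_derivative assms(4)) auto
  from MVT2[OF assms(1) this] obtain \<eta> where \<eta>: "0 < \<eta>" "\<eta> < t"
    "partial_deriv i f (?z + t *\<^sub>R axis j 1) - partial_deriv i f (?z + 0 *\<^sub>R axis j 1)
      = t * partial_deriv j (partial_deriv i f) (?z + \<eta> *\<^sub>R axis j 1)"
    by auto
  have "x + t *\<^sub>R axis j 1 + \<xi> *\<^sub>R axis i 1 = ?z + t *\<^sub>R axis j 1" by simp
  then have "?\<phi>' \<xi> = t * partial_deriv j (partial_deriv i f) (?z + \<eta> *\<^sub>R axis j 1)"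
    using \<eta>(3) by (simp only: scaleR_zero_left add_0_right)
  with \<xi>(3) have "?\<phi> t - ?\<phi> 0 = t\<^sup>2 * partial_deriv j (partial_deriv i f) (?z + \<eta> *\<^sub>R axis j 1)"
    by (simp add: power2_eq_square)
  moreover have "x + t *\<^sub>R axis i 1 + t *\<^sub>R axis j 1 = x + t *\<^sub>R axis j 1 + t *\<^sub>R axis i 1" by simp
  then have "f (x + t *\<^sub>R axis i 1 + t *\<^sub>R axis j 1) - f (x + t *\<^sub>R axis i 1) - f (x + t *\<^sub>R axis j 1) + f x
      = ?\<phi> t - ?\<phi> 0" by (simp only:) simp
  moreover have "?z + \<eta> *\<^sub>R axis j 1 \<in> cball x (2 * t)" using U \<xi> \<eta> by simp
  ultimately show ?thesis by (intro bexI[of _ "?z + \<eta> *\<^sub>R axis j 1"]) (simp_all only:)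
qed

text \<open>The second difference does not change when \<open>i\<close> and \<open>j\<close> are
  exchanged. Divided by the square of the step it is therefore each of the mixed derivatives at some
  point near \<open>x\<close>; both points tend to \<open>x\<close>, and continuity finishes the
  argument.\<close>

lemma partial_deriv_commute:
  fixes f :: "real^'n::finite \<Rightarrow> real"
  assumes "open U" "x \<in> U"
    and d: "\<And>y. y \<in> U \<Longrightarrow> f differentiable (at y)"
    and dd: "\<And>y k. y \<in> U \<Longrightarrow> partial_deriv k f differentiable (at y)"
    and cont: "\<And>k l. continuous_on U (partial_deriv k (partial_deriv l f))"
  shows "partial_deriv i (partial_deriv j f) x = partial_deriv j (partial_deriv i f) x"
proof -
  obtain r where r: "r > 0" "cball x r \<subseteq> U"
    using assms(1,2) open_contains_cball by blast
  \<comment> \<open>The 2 fits the ball of radius \<open>2 * ?t n\<close> into the one of radius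
    \<open>r\<close>; \<open>Suc n\<close> makes it shrink to \<open>x\<close>.\<close>
  let ?t = "\<lambda>n. r / (2 * real (Suc n))"
  have t: "0 < ?t n" "cball x (2 * ?t n) \<subseteq> U" for n
  proof -
    have "2 * ?t n \<le> r" using r(1) by (simp add: field_simps)
    then show "cball x (2 * ?t n) \<subseteq> U" using r(2) by (meson subset_cball subset_trans)
  qed (use r in simp)
  let ?\<Delta> = "\<lambda>n. f (x + ?t n *\<^sub>R axis i 1 + ?t n *\<^sub>R axis j 1) - f (x + ?t n *\<^sub>R axis i 1) - f (x + ?t n *\<^sub>R axis j 1) + f x"
  have "\<exists>y\<in>cball x (2 * ?t n). ?\<Delta> n = (?t n)\<^sup>2 * partial_deriv j (partial_deriv i f) y" for n
    by (rule second_difference_eq[OF t d dd])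
  then obtain y where y: "\<And>n. y n \<in> cball x (2 * ?t n)"
    "\<And>n. ?\<Delta> n = (?t n)\<^sup>2 * partial_deriv j (partial_deriv i f) (y n)" by metis
  have "\<exists>y\<in>cball x (2 * ?t n). ?\<Delta> n = (?t n)\<^sup>2 * partial_deriv i (partial_deriv j f) y" for n
    using second_difference_eq[OF t d dd, of n j i] by (simp add: algebra_simps)
  then obtain z where z: "\<And>n. z n \<in> cball x (2 * ?t n)"
    "\<And>n. ?\<Delta> n = (?t n)\<^sup>2 * partial_deriv i (partial_deriv j f) (z n)" by metis
  have t0: "(\<lambda>n. 2 * ?t n) \<longlonglongrightarrow> 0"
  proof -
    have "(\<lambda>n. r * inverse (real (Suc n))) \<longlonglongrightarrow> r * 0"
      by (intro tendsto_intros LIMSEQ_inverse_real_of_nat)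
    moreover have "2 * ?t n = r * inverse (real (Suc n))" for n
      by (simp add: field_simps del: of_nat_Suc)
    ultimately show ?thesis by simp
  qed
  have lim: "(\<lambda>n. partial_deriv k (partial_deriv l f) (w n)) \<longlonglongrightarrow> partial_deriv k (partial_deriv l f) x"
    if "\<And>n. w n \<in> cball x (2 * ?t n)" for w k l
  proof -
    have "w \<longlonglongrightarrow> x"
      using that t0 by (intro metric_tendsto_imp_tendsto[OF t0, of w x] always_eventually)
        (use r(1) in \<open>auto simp: dist_commute abs_of_pos\<close>)
    moreover have "continuous (at x) (partial_deriv k (partial_deriv l f))"
      using cont[of k l] assms(1,2) continuous_on_eq_continuous_at by blast
    ultimately show ?thesis by (simp add: isCont_tendsto_compose)
  qed
  have "partial_deriv i (partial_deriv j f) (z n) = partial_deriv j (partial_deriv i f) (y n)" for n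
    using y(2)[of n] z(2)[of n] t(1)[of n] r(1) by simp
  then have "(\<lambda>n. partial_deriv j (partial_deriv i f) (y n)) \<longlonglongrightarrow> partial_deriv i (partial_deriv j f) x"
    using lim[of z i j, OF z(1)] by simp
  then show ?thesis using lim[of y j i, OF y(1)] LIMSEQ_unique by blast
qed

lemma smooth_onD:
  assumes "smooth_on U f"
  shows "\<And>x. x \<in> U \<Longrightarrow> f differentiable (at x)" and "smooth_on U (partial_deriv i f)"
    and "continuous_on U f"
  using assms[unfolded smooth_on_def, rule_format, of "Suc _"]
    assms[unfolded smooth_on_def, rule_format, of "Suc 0"]
    assms[unfolded smooth_on_def, rule_format, of "0"]
  by (auto simp: smooth_on_def)

lemma smooth_on_partial_deriv_commute:
  assumes "open U" "x \<in> U" "smooth_on U f"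
  shows "partial_deriv i (partial_deriv j f) x = partial_deriv j (partial_deriv i f) x"
  by (intro partial_deriv_commute[OF assms(1,2)] smooth_onD[OF assms(3)]
      smooth_onD[OF smooth_onD(2)[OF assms(3)]]
      smooth_onD(3)[OF smooth_onD(2)[OF smooth_onD(2)[OF assms(3)]]])

section \<open>Calculus in a chart\<close>

lemma Ck_on_cong:
  assumes "open U" "\<And>x. x \<in> U \<Longrightarrow> f x = g x" "Ck_on k U f"
  shows "Ck_on k U g"
  using assms(2,3)
proof (induction k arbitrary: f g)
  case 0
  then show ?case using continuous_on_cong by force
next
  case (Suc k)
  have "g differentiable (at x)" if "x \<in> U" for x
    using differentiable_cong_open[OF assms(1) that Suc.prems(1)] Suc.prems(2) that by auto
  moreover have "Ck_on k U (partial_deriv i g)" for i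
  proof (rule Suc.IH)
    show "partial_deriv i f x = partial_deriv i g x" if "x \<in> U" for x
      by (rule partial_deriv_cong[OF assms(1) that Suc.prems(1)])
    show "Ck_on k U (partial_deriv i f)" using Suc.prems(2) by simp
  qed
  ultimately show ?case by simp
qed

definition chart_differentiable :: "('a, 'n::finite) chart \<Rightarrow> ('a \<Rightarrow> real) \<Rightarrow> 'a \<Rightarrow> bool" where
  "chart_differentiable c f p \<longleftrightarrow> coord_expr c f differentiable (at (snd c p))"

lemma chart_differentiable_const [simp]: "chart_differentiable c (\<lambda>p. a) p"
  by (simp add: chart_differentiable_def coord_expr_def comp_def)

lemma chart_differentiable_add [intro]:
  "chart_differentiable c f p \<Longrightarrow> chart_differentiable c g p \<Longrightarrow> chart_differentiable c (\<lambda>q. f q + g q) p"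
  by (simp add: chart_differentiable_def coord_expr_def comp_def)

lemma chart_differentiable_diff [intro]:
  "chart_differentiable c f p \<Longrightarrow> chart_differentiable c g p \<Longrightarrow> chart_differentiable c (\<lambda>q. f q - g q) p"
  by (simp add: chart_differentiable_def coord_expr_def comp_def)

lemma chart_differentiable_mult [intro]:
  "chart_differentiable c f p \<Longrightarrow> chart_differentiable c g p \<Longrightarrow> chart_differentiable c (\<lambda>q. f q * g q) p"
  by (simp add: chart_differentiable_def coord_expr_def comp_def)

lemma chart_differentiable_sum [intro]:
  assumes "\<And>a. a \<in> S \<Longrightarrow> chart_differentiable c (f a) p"
  shows "chart_differentiable c (\<lambda>q. \<Sum>a\<in>S. f a q) p"
  using assms by (induction S rule: infinite_finite_induct) auto

lemma chart_differentiable_prod [intro]: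
  assumes "\<And>a. a \<in> S \<Longrightarrow> chart_differentiable c (f a) p"
  shows "chart_differentiable c (\<lambda>q. \<Prod>a\<in>S. f a q) p"
  using assms by (induction S rule: infinite_finite_induct) auto

lemma chart_partial_const [simp]: "chart_partial c i (\<lambda>q. a) p = 0"
  by (simp add: chart_partial_def coord_expr_def comp_def partial_deriv_const)

lemma chart_partial_add:
  "chart_differentiable c f p \<Longrightarrow> chart_differentiable c g p \<Longrightarrow>
    chart_partial c i (\<lambda>q. f q + g q) p = chart_partial c i f p + chart_partial c i g p"
  by (simp add: chart_differentiable_def chart_partial_def coord_expr_def comp_def partial_deriv_add)

text \<open>Values of the factors enter the product rule but not the sum rule, and
  \<open>coord_expr\<close> recovers them through \<open>inv_into\<close>, which returns
  \<open>p\<close> by injectivity of the chart.\<close>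

lemma chart_partial_mult:
  assumes "chart_differentiable c f p" "chart_differentiable c g p" "p \<in> fst c" "inj_on (snd c) (fst c)"
  shows "chart_partial c i (\<lambda>q. f q * g q) p = chart_partial c i f p * g p + f p * chart_partial c i g p"
proof -
  have "inv_into (fst c) (snd c) (snd c p) = p" using assms(3,4) by simp
  then show ?thesis
    using assms(1,2) by (simp add: chart_differentiable_def chart_partial_def coord_expr_def comp_def partial_deriv_mult)
qed

lemma chart_partial_sum:
  assumes "\<And>a. a \<in> S \<Longrightarrow> chart_differentiable c (f a) p"
  shows "chart_partial c i (\<lambda>q. \<Sum>a\<in>S. f a q) p = (\<Sum>a\<in>S. chart_partial c i (f a) p)"
  using assms by (induction S rule: infinite_finite_induct)
    (auto simp: chart_partial_add chart_differentiable_sum)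

text \<open>\<open>V\<close> is the whole domain of the chart for the local geometry, and the
  intersection with the domain of a second chart for the transformation laws.\<close>

locale chart_domain =
  fixes c :: "('a, 'n::finite) chart" and V :: "'a set"
  assumes domain_subset: "V \<subseteq> fst c"
    and inj_chart: "inj_on (snd c) (fst c)"
    and open_image: "open (snd c ` V)"
begin

definition chart_smooth :: "('a \<Rightarrow> real) \<Rightarrow> bool" where
  "chart_smooth f \<longleftrightarrow> smooth_on (snd c ` V) (coord_expr c f)"

lemma coord_expr_apply: "p \<in> V \<Longrightarrow> coord_expr c f (snd c p) = f p"
  using domain_subset inj_chart by (auto simp: coord_expr_def)

lemma chart_partial_cong:
  assumes "p \<in> V" "\<And>q. q \<in> V \<Longrightarrow> f q = g q"
  shows "chart_partial c i f p = chart_partial c i g p"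
  unfolding chart_partial_def
  by (rule partial_deriv_cong[OF open_image]) (use assms in \<open>auto simp: coord_expr_apply\<close>)

lemma chart_differentiable_cong:
  assumes "p \<in> V" "\<And>q. q \<in> V \<Longrightarrow> f q = g q" "chart_differentiable c f p"
  shows "chart_differentiable c g p"
  unfolding chart_differentiable_def
  by (rule differentiable_cong_open[OF open_image, of _ "coord_expr c f"])
    (use assms in \<open>auto simp: coord_expr_apply chart_differentiable_def\<close>)

lemma chart_partial_times:
  "\<lbrakk>p \<in> V; chart_differentiable c f p; chart_differentiable c g p\<rbrakk> \<Longrightarrow>
    chart_partial c i (\<lambda>q. f q * g q) p = chart_partial c i f p * g p + f p * chart_partial c i g p"
  using domain_subset inj_chart by (auto intro!: chart_partial_mult)

lemma chart_partial_cmult: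
  "\<lbrakk>p \<in> V; chart_differentiable c f p\<rbrakk> \<Longrightarrow> chart_partial c i (\<lambda>q. a * f q) p = a * chart_partial c i f p"
  using chart_partial_times[of p "\<lambda>q. a" f] by simp

lemma chart_partial_diff:
  assumes "p \<in> V" "chart_differentiable c f p" "chart_differentiable c g p"
  shows "chart_partial c i (\<lambda>q. f q - g q) p = chart_partial c i f p - chart_partial c i g p"
  using chart_partial_add[of c f p "\<lambda>q. (-1) * g q" i] chart_partial_cmult[OF assms(1,3), of i "-1"]
    chart_differentiable_mult[of c "\<lambda>q. -1" p g] assms by simp

lemma coord_expr_chart_partial:
  assumes "y \<in> snd c ` V"
  shows "coord_expr c (chart_partial c i f) y = partial_deriv i (coord_expr c f) y"
  using assms by (auto simp: coord_expr_apply chart_partial_def)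

lemma chart_smooth_differentiable: "chart_smooth f \<Longrightarrow> p \<in> V \<Longrightarrow> chart_differentiable c f p"
  by (auto simp: chart_smooth_def chart_differentiable_def intro: smooth_onD)

lemma chart_smooth_partial:
  assumes "chart_smooth f" shows "chart_smooth (chart_partial c i f)"
  unfolding chart_smooth_def smooth_on_def
proof
  fix k
  have "Ck_on k (snd c ` V) (partial_deriv i (coord_expr c f))"
    using smooth_onD(2) assms by (auto simp: chart_smooth_def smooth_on_def)
  then show "Ck_on k (snd c ` V) (coord_expr c (chart_partial c i f))"
    by (rule Ck_on_cong[OF open_image, rotated]) (simp add: coord_expr_chart_partial)
qed

lemma chart_partial_commute:
  assumes "chart_smooth f" "p \<in> V"
  shows "chart_partial c i (chart_partial c j f) p = chart_partial c j (chart_partial c i f) p"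
proof -
  have "chart_partial c i (chart_partial c j f) p = partial_deriv i (partial_deriv j (coord_expr c f)) (snd c p)" for i j
    unfolding chart_partial_def[of c i "chart_partial c j f"]
    by (rule partial_deriv_cong[OF open_image]) (use assms in \<open>auto simp: coord_expr_chart_partial\<close>)
  then show ?thesis
    using smooth_on_partial_deriv_commute[OF open_image] assms by (auto simp: chart_smooth_def)
qed

end

section \<open>Matrices and finite sums\<close>

lemma sum_pairs_swap:
  fixes f :: "'a::finite \<Rightarrow> 'b::finite \<Rightarrow> 'c::finite \<Rightarrow> 'd::finite \<Rightarrow> 'e::comm_monoid_add"
  shows "(\<Sum>i\<in>UNIV. \<Sum>j\<in>UNIV. \<Sum>k\<in>UNIV. \<Sum>l\<in>UNIV. f i j k l) = (\<Sum>k\<in>UNIV. \<Sum>l\<in>UNIV. \<Sum>i\<in>UNIV. \<Sum>j\<in>UNIV. f i j k l)"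
proof -
  have "(\<Sum>i\<in>UNIV. \<Sum>j\<in>UNIV. \<Sum>k\<in>UNIV. \<Sum>l\<in>UNIV. f i j k l) = (\<Sum>i\<in>UNIV. \<Sum>k\<in>UNIV. \<Sum>j\<in>UNIV. \<Sum>l\<in>UNIV. f i j k l)"
    by (intro sum.cong refl sum.swap)
  also have "\<dots> = (\<Sum>k\<in>UNIV. \<Sum>i\<in>UNIV. \<Sum>l\<in>UNIV. \<Sum>j\<in>UNIV. f i j k l)"
    by (subst sum.swap) (intro sum.cong refl sum.swap)
  also have "\<dots> = (\<Sum>k\<in>UNIV. \<Sum>l\<in>UNIV. \<Sum>i\<in>UNIV. \<Sum>j\<in>UNIV. f i j k l)"
    by (intro sum.cong refl sum.swap)
  finally show ?thesis .
qed

lemma sum_rotate: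
  "(\<Sum>j\<in>S. \<Sum>k\<in>T. \<Sum>a\<in>U. f j k a) = (\<Sum>a\<in>U. \<Sum>j\<in>S. \<Sum>k\<in>T. f j k a)"
proof -
  have "(\<Sum>j\<in>S. \<Sum>k\<in>T. \<Sum>a\<in>U. f j k a) = (\<Sum>j\<in>S. \<Sum>a\<in>U. \<Sum>k\<in>T. f j k a)"
    by (intro sum.cong refl sum.swap)
  then show ?thesis by (simp only: sum.swap[of _ S U])
qed

text \<open>The two adjacent transpositions generate all six permutations, and each is a renaming of
  summation indices that the symmetric factor does not notice.\<close>

lemma sum_sym3:
  fixes U X :: "'n::finite \<Rightarrow> 'n \<Rightarrow> 'n \<Rightarrow> real"
  assumes U12: "\<And>a b e. U a b e = U b a e" and U23: "\<And>a b e. U a b e = U a e b"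
  shows "(\<Sum>a\<in>UNIV. \<Sum>b\<in>UNIV. \<Sum>e\<in>UNIV. U a b e * sym3 X a b e)
    = (\<Sum>a\<in>UNIV. \<Sum>b\<in>UNIV. \<Sum>e\<in>UNIV. U a b e * X a b e)"
proof -
  let ?S = "\<lambda>Y. \<Sum>a\<in>UNIV. \<Sum>b\<in>UNIV. \<Sum>e\<in>UNIV. U a b e * Y a b e"
  have 12: "?S Y = ?S (\<lambda>a b e. Y b a e)" for Y
  proof -
    have "?S Y = (\<Sum>a\<in>UNIV. \<Sum>b\<in>UNIV. \<Sum>e\<in>UNIV. U b a e * Y b a e)" by (rule sum.swap)
    then show ?thesis by (simp add: U12[symmetric])
  qed
  have 23: "?S Y = ?S (\<lambda>a b e. Y a e b)" for Y
  proof -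
    have "?S Y = (\<Sum>a\<in>UNIV. \<Sum>b\<in>UNIV. \<Sum>e\<in>UNIV. U a e b * Y a e b)"
      by (intro sum.cong refl sum.swap)
    then show ?thesis by (simp add: U23[symmetric])
  qed
  have "?S (sym3 X) = (1/6) * (?S X + ?S (\<lambda>a b e. X a e b) + ?S (\<lambda>a b e. X b a e)
      + ?S (\<lambda>a b e. X b e a) + ?S (\<lambda>a b e. X e a b) + ?S (\<lambda>a b e. X e b a))"
    by (simp add: sym3_def sum_distrib_left sum.distrib distrib_left mult_ac)
  then show ?thesis
    using 23[of X] 12[of X] 12[of "\<lambda>a b e. X a e b"] 23[of "\<lambda>a b e. X b a e"] 12[of "\<lambda>a b e. X e a b"]
    by simp
qed

lemma matrix_add_rdistrib: "(A + B) ** C = A ** C + B ** (C :: 'a::semiring_1^'n^'m)"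
  by (vector matrix_matrix_mult_def sum.distrib distrib_right)

lemma matrix_diff_ldistrib: "A ** (B - C) = A ** B - A ** (C :: 'a::ring_1^'n^'m)"
  by (vector matrix_matrix_mult_def sum_subtractf right_diff_distrib)

lemma matrix_diff_rdistrib: "(A - B) ** C = A ** C - B ** (C :: 'a::ring_1^'n^'m)"
  by (vector matrix_matrix_mult_def sum_subtractf left_diff_distrib)

lemma matrix_scaleR_mult: "(r *\<^sub>R A) ** B = r *\<^sub>R (A ** (B :: real^'n^'m))"
  by (vector matrix_matrix_mult_def sum_distrib_left mult.assoc)

lemma matrix_mult_scaleR: "A ** (r *\<^sub>R B) = r *\<^sub>R (A ** (B :: real^'n^'m))"
  by (vector matrix_matrix_mult_def sum_distrib_left mult.left_commute)

lemmas matrix_ring_simps = matrix_add_ldistrib matrix_add_rdistrib matrix_diff_ldistrib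
  matrix_diff_rdistrib matrix_scaleR_mult matrix_mult_scaleR matrix_mul_assoc

lemma transpose_matrix_add: "transpose (A + B) = transpose A + transpose B"
  by (simp add: transpose_def vec_eq_iff)

lemma transpose_matrix_diff: "transpose (A - B) = transpose A - transpose B"
  by (simp add: transpose_def vec_eq_iff)

lemma skew_matrix_component:
  assumes "transpose A = - (A :: 'a::ring_1^'n^'n)"
  shows "A $ l $ m = - A $ m $ l"
proof -
  have "transpose A $ m $ l = - A $ m $ l" by (simp add: assms)
  then show ?thesis by (simp add: transpose_def)
qed

lemma matrix_minus_left: "(- A) ** B = - (A ** (B :: 'a::ring_1^'n^'m))"
  by (simp add: vec_eq_iff matrix_matrix_mult_def sum_negf)

lemma matrix_minus_right: "A ** (- B) = - (A ** (B :: 'a::ring_1^'n^'m))"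
  by (simp add: vec_eq_iff matrix_matrix_mult_def sum_negf)

lemma trace_minus: "trace (- A) = - trace (A :: 'a::ring_1^'n^'n)"
  by (simp add: trace_def sum_negf)

lemma matrix_sum_rdistrib: "(\<Sum>a\<in>S. Y a) ** B = (\<Sum>a\<in>S. Y a ** (B :: 'a::semiring_1^'n^'m))"
  by (induction S rule: infinite_finite_induct) (simp_all add: matrix_add_rdistrib)

lemma matrix_sum_ldistrib: "B ** (\<Sum>a\<in>S. Y a) = (\<Sum>a\<in>S. (B :: 'a::semiring_1^'n^'m) ** Y a)"
  by (induction S rule: infinite_finite_induct) (simp_all add: matrix_add_ldistrib)

lemma trace_sum_scaleR: "trace (\<Sum>a\<in>S. x a *\<^sub>R Y a) = (\<Sum>a\<in>S. x a * trace (Y a :: real^'n^'n))"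
  unfolding trace_def by (simp add: sum_distrib_left) (rule sum.swap)

lemma trace_scaleR: "trace (r *\<^sub>R A) = r * trace (A :: real^'n^'n)"
  by (simp add: trace_def sum_distrib_left)

lemma trace_sum: "trace (\<Sum>a\<in>S. Y a) = (\<Sum>a\<in>S. trace (Y a :: real^'n^'n))"
  unfolding trace_def by simp (rule sum.swap)

lemma trace_mult_sym:
  fixes H Y :: "real^'n^'n"
  assumes "\<And>j l. H $ j $ l = H $ l $ j"
  shows "(\<Sum>j\<in>UNIV. \<Sum>l\<in>UNIV. H $ j $ l * Y $ j $ l) = trace (H ** Y)"
proof -
  have "trace (H ** Y) = (\<Sum>j\<in>UNIV. \<Sum>l\<in>UNIV. H $ j $ l * Y $ l $ j)"
    by (simp add: trace_def matrix_matrix_mult_def)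
  also have "\<dots> = (\<Sum>l\<in>UNIV. \<Sum>j\<in>UNIV. H $ j $ l * Y $ l $ j)" by (rule sum.swap)
  finally show ?thesis by (simp add: assms)
qed

text \<open>Applied to the metric: an equation between multiples of \<open>g\<close> can be divided
  by a nonzero component.\<close>

lemma invertible_imp_nonzero_entry:
  fixes B :: "real^'n^'n"
  assumes "invertible B" shows "\<exists>i j. B $ i $ j \<noteq> 0"
proof (rule ccontr)
  assume "\<not> ?thesis"
  then have B: "B = 0" by (simp add: vec_eq_iff)
  obtain C where "B ** C = mat 1" using assms invertible_def by blast
  then have "(0 :: real^'n^'n) = mat 1" by (simp add: B)
  then have "(0 :: real^'n^'n) $ i $ i = mat 1 $ i $ i" for i by simp
  then show False by (simp add: mat_def)
qed

section \<open>Matrix-valued functions\<close>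

definition mat_differentiable :: "('a, 'n::finite) chart \<Rightarrow> ('a \<Rightarrow> real^'m^'k) \<Rightarrow> 'a \<Rightarrow> bool" where
  "mat_differentiable c Y p \<longleftrightarrow> (\<forall>k l. chart_differentiable c (\<lambda>q. Y q $ k $ l) p)"

definition mat_partial :: "('a, 'n::finite) chart \<Rightarrow> 'n \<Rightarrow> ('a \<Rightarrow> real^'m^'k) \<Rightarrow> 'a \<Rightarrow> real^'m^'k" where
  "mat_partial c i Y p = (\<chi> k l. chart_partial c i (\<lambda>q. Y q $ k $ l) p)"

lemma mat_differentiable_add:
  "mat_differentiable c Y p \<Longrightarrow> mat_differentiable c Z p \<Longrightarrow> mat_differentiable c (\<lambda>q. Y q + Z q) p"
  by (auto simp: mat_differentiable_def)

lemma mat_differentiable_diff: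
  "mat_differentiable c Y p \<Longrightarrow> mat_differentiable c Z p \<Longrightarrow> mat_differentiable c (\<lambda>q. Y q - Z q) p"
  by (auto simp: mat_differentiable_def)

lemma mat_differentiable_mult:
  "mat_differentiable c Y p \<Longrightarrow> mat_differentiable c Z p \<Longrightarrow> mat_differentiable c (\<lambda>q. Y q ** Z q) p"
  by (auto simp: mat_differentiable_def matrix_matrix_mult_def
      intro!: chart_differentiable_sum chart_differentiable_mult)

lemma mat_differentiable_scaleR:
  "mat_differentiable c Y p \<Longrightarrow> mat_differentiable c (\<lambda>q. r *\<^sub>R Y q) p"
  by (auto simp: mat_differentiable_def)

lemma mat_differentiable_transpose:
  "mat_differentiable c Y p \<Longrightarrow> mat_differentiable c (\<lambda>q. transpose (Y q)) p"
  by (auto simp: mat_differentiable_def transpose_def)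

lemmas mat_differentiable_intros = mat_differentiable_add mat_differentiable_diff
  mat_differentiable_mult mat_differentiable_scaleR mat_differentiable_transpose

lemma mat_partial_add:
  "mat_differentiable c Y p \<Longrightarrow> mat_differentiable c Z p \<Longrightarrow>
    mat_partial c i (\<lambda>q. Y q + Z q) p = mat_partial c i Y p + mat_partial c i Z p"
  by (simp add: mat_differentiable_def mat_partial_def vec_eq_iff chart_partial_add)

lemma mat_partial_transpose: "mat_partial c i (\<lambda>q. transpose (Y q)) p = transpose (mat_partial c i Y p)"
  by (simp add: mat_partial_def transpose_def)

context chart_domain
begin

lemma mat_partial_cong:
  "p \<in> V \<Longrightarrow> (\<And>q. q \<in> V \<Longrightarrow> Y q = Z q) \<Longrightarrow> mat_partial c i Y p = mat_partial c i Z p"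
  by (auto simp: mat_partial_def vec_eq_iff intro!: chart_partial_cong)

lemma mat_partial_diff:
  "p \<in> V \<Longrightarrow> mat_differentiable c Y p \<Longrightarrow> mat_differentiable c Z p \<Longrightarrow>
    mat_partial c i (\<lambda>q. Y q - Z q) p = mat_partial c i Y p - mat_partial c i Z p"
  by (simp add: mat_differentiable_def mat_partial_def vec_eq_iff chart_partial_diff)

lemma mat_partial_scaleR:
  "p \<in> V \<Longrightarrow> mat_differentiable c Y p \<Longrightarrow> mat_partial c i (\<lambda>q. r *\<^sub>R Y q) p = r *\<^sub>R mat_partial c i Y p"
  by (simp add: mat_differentiable_def mat_partial_def vec_eq_iff chart_partial_cmult)

lemma mat_partial_mult:
  assumes "p \<in> V" "mat_differentiable c Y p" "mat_differentiable c Z p"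
  shows "mat_partial c i (\<lambda>q. Y q ** Z q) p = mat_partial c i Y p ** Z p + Y p ** mat_partial c i Z p"
  using assms
  by (simp add: mat_differentiable_def mat_partial_def vec_eq_iff matrix_matrix_mult_def chart_partial_sum
      chart_differentiable_mult chart_partial_times sum.distrib)

lemma chart_partial_trace:
  assumes "mat_differentiable c Y p"
  shows "chart_partial c i (\<lambda>q. trace (Y q)) p = trace (mat_partial c i Y p)"
  using assms by (simp add: mat_differentiable_def trace_def mat_partial_def chart_partial_sum)

definition mat_smooth :: "('a \<Rightarrow> real^'m^'k) \<Rightarrow> bool" where
  "mat_smooth Y \<longleftrightarrow> (\<forall>k l. chart_smooth (\<lambda>q. Y q $ k $ l))"

lemma mat_smooth_differentiable: "mat_smooth Y \<Longrightarrow> p \<in> V \<Longrightarrow> mat_differentiable c Y p"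
  by (auto simp: mat_smooth_def mat_differentiable_def chart_smooth_differentiable)

lemma mat_smooth_partial: "mat_smooth Y \<Longrightarrow> mat_smooth (mat_partial c i Y)"
  using chart_smooth_partial by (simp add: mat_smooth_def mat_partial_def)

lemma mat_partial_commute:
  "mat_smooth Y \<Longrightarrow> p \<in> V \<Longrightarrow> mat_partial c i (mat_partial c j Y) p = mat_partial c j (mat_partial c i Y) p"
  using chart_partial_commute by (simp add: mat_smooth_def mat_partial_def vec_eq_iff)

end

section \<open>Curvature of connection matrices\<close>

text \<open>The row index of a matrix is the lower and the column index the upper index of an endomorphism,
  so matrix products compose endomorphisms in reverse order.\<close>

definition conn_mat :: "('a, 'n::finite) comp3 \<Rightarrow> ('a, 'n) chart \<Rightarrow> 'n \<Rightarrow> 'a \<Rightarrow> real^'n^'n" where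
  "conn_mat \<Gamma> c i p = (\<chi> k l. \<Gamma> c p i k l)"

definition curv_mat :: "('a, 'n::finite) comp3 \<Rightarrow> ('a, 'n) chart \<Rightarrow> 'n \<Rightarrow> 'n \<Rightarrow> 'a \<Rightarrow> real^'n^'n" where
  "curv_mat \<Gamma> c i j p = (\<chi> k l. curvature \<Gamma> c p i j k l)"

text \<open>The quadratic terms have the signs opposite to the usual formula because products
  compose in reverse order.\<close>

lemma curv_mat_eq:
  "curv_mat \<Gamma> c i j p = mat_partial c i (conn_mat \<Gamma> c j) p - mat_partial c j (conn_mat \<Gamma> c i) p
     + conn_mat \<Gamma> c j p ** conn_mat \<Gamma> c i p - conn_mat \<Gamma> c i p ** conn_mat \<Gamma> c j p"
  by (simp add: vec_eq_iff curv_mat_def curvature_def conn_mat_def mat_partial_def matrix_matrix_mult_def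
      mult.commute)

lemma curv_mat_antisym: "curv_mat \<Gamma> c i j p = - curv_mat \<Gamma> c j i p"
  by (simp add: curv_mat_eq)

text \<open>The form index of \<open>\<omega>\<^sub>j\<close> or \<open>R\<^sub>j\<^sub>k\<close> is not differentiated covariantly here; this gives the
  exterior covariant derivative once antisymmetrized.\<close>

definition nabla_end ::
  "('a, 'n::finite) comp3 \<Rightarrow> ('a, 'n) chart \<Rightarrow> 'n \<Rightarrow> ('a \<Rightarrow> real^'n^'n) \<Rightarrow> 'a \<Rightarrow> real^'n^'n" where
  "nabla_end \<Gamma> c i Y p = mat_partial c i Y p + Y p ** conn_mat \<Gamma> c i p - conn_mat \<Gamma> c i p ** Y p"

definition nabla_form ::
  "('a, 'n::finite) comp3 \<Rightarrow> ('a, 'n) chart \<Rightarrow> 'n \<Rightarrow> ('a \<Rightarrow> real^'n^'n) \<Rightarrow> 'a \<Rightarrow> real^'n^'n" where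
  "nabla_form \<Gamma> c i Y p = mat_partial c i Y p - conn_mat \<Gamma> c i p ** Y p - Y p ** transpose (conn_mat \<Gamma> c i p)"

lemma cov_deriv_eq_nabla_form:
  "cov_deriv \<Gamma> T c p i j k = nabla_form \<Gamma> c i (\<lambda>q. \<chi> a b. T c q a b) p $ j $ k"
  by (simp add: cov_deriv_def nabla_form_def mat_partial_def conn_mat_def matrix_matrix_mult_def
      transpose_def mult.commute)

lemma nabla_form_skew:
  assumes "transpose (mat_partial c i Y p) = - mat_partial c i Y p" and "transpose (Y p) = - Y p"
  shows "transpose (nabla_form \<Gamma> c i Y p) = - nabla_form \<Gamma> c i Y p"
  by (simp add: nabla_form_def transpose_matrix_diff matrix_transpose_mul assms matrix_minus_left matrix_minus_right)

context chart_domain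
begin

lemma mat_differentiable_curv_mat:
  assumes "\<And>i. mat_smooth (conn_mat \<Gamma> c i)" "p \<in> V"
  shows "mat_differentiable c (curv_mat \<Gamma> c i j) p"
proof -
  have "mat_differentiable c (\<lambda>q. mat_partial c i (conn_mat \<Gamma> c j) q - mat_partial c j (conn_mat \<Gamma> c i) q
     + conn_mat \<Gamma> c j q ** conn_mat \<Gamma> c i q - conn_mat \<Gamma> c i q ** conn_mat \<Gamma> c j q) p"
    by (intro mat_differentiable_intros mat_smooth_differentiable mat_smooth_partial assms)
  then show ?thesis by (simp add: curv_mat_eq[abs_def])
qed

text \<open>In the cyclic sum the second derivatives cancel because partial derivatives commute, and
  the products of a derivative with a connection matrix, as well as the triple products, cancel in
  the matrix ring.\<close>

lemma second_bianchi_end: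
  assumes sm: "\<And>i. mat_smooth (conn_mat \<Gamma> c i)" and p: "p \<in> V"
  shows "nabla_end \<Gamma> c i (curv_mat \<Gamma> c j k) p + nabla_end \<Gamma> c j (curv_mat \<Gamma> c k i) p
    + nabla_end \<Gamma> c k (curv_mat \<Gamma> c i j) p = 0"
proof -
  let ?w = "conn_mat \<Gamma> c" and ?d = "mat_partial c"
  note d = mat_smooth_differentiable[OF sm p] mat_smooth_differentiable[OF mat_smooth_partial[OF sm] p]
  have "?d i (curv_mat \<Gamma> c j k) p = ?d i (?d j (?w k)) p - ?d i (?d k (?w j)) p
     + (?d i (?w k) p ** ?w j p + ?w k p ** ?d i (?w j) p)
     - (?d i (?w j) p ** ?w k p + ?w j p ** ?d i (?w k) p)" for i j k
    unfolding curv_mat_eq[abs_def]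
    by (simp add: mat_partial_add mat_partial_diff mat_partial_mult d p mat_differentiable_intros)
  note dF = this
  show ?thesis
    by (simp add: nabla_end_def dF curv_mat_eq matrix_ring_simps mat_partial_commute[OF sm p, of i j k]
        mat_partial_commute[OF sm p, of j k i] mat_partial_commute[OF sm p, of k i j])
qed

end

lemma det_differentiable:
  assumes "mat_differentiable c Y p"
  shows "chart_differentiable c (\<lambda>q. det (Y q)) p"
  unfolding det_def using assms
  by (intro chart_differentiable_sum chart_differentiable_mult chart_differentiable_prod
      chart_differentiable_const) (simp add: mat_differentiable_def)

section \<open>The Levi-Civita connection\<close>

locale levi_civita_chart = chart_domain c "fst c" for c :: "('a, 'n::finite) chart" +
  fixes g :: "('a, 'n) comp2" and D :: "('a, 'n) comp3"
  assumes g_smooth: "chart_smooth (\<lambda>p. g c p i j)"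
    and g_sym: "p \<in> fst c \<Longrightarrow> g c p i j = g c p j i"
    and g_invertible: "p \<in> fst c \<Longrightarrow> invertible (\<chi> i j. g c p i j)"
    and D_smooth: "chart_smooth (\<lambda>p. D c p i j k)"
    and D_sym: "p \<in> fst c \<Longrightarrow> D c p i j k = D c p j i k"
    and D_metric: "p \<in> fst c \<Longrightarrow> cov_deriv D g c p i j k = 0"
begin

abbreviation "G p \<equiv> (\<chi> i j. g c p i j)"
abbreviation "H p \<equiv> (\<chi> i j. ginv g c p i j)"
abbreviation "\<omega> \<equiv> conn_mat D c"
abbreviation "F \<equiv> curv_mat D c"

lemma H_eq: "H p = matrix_inv (G p)"
  by (simp add: vec_eq_iff ginv_def)

lemma GH: "p \<in> fst c \<Longrightarrow> G p ** H p = mat 1" and HG: "p \<in> fst c \<Longrightarrow> H p ** G p = mat 1"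
  using g_invertible unfolding H_eq matrix_inv_def invertible_def by (metis (mono_tags, lifting) someI_ex)+

lemma G_transpose: "p \<in> fst c \<Longrightarrow> transpose (G p) = G p"
  by (simp add: vec_eq_iff transpose_def g_sym)

lemma H_transpose:
  assumes "p \<in> fst c" shows "transpose (H p) = H p"
proof -
  have "transpose (H p) ** G p = mat 1"
    using GH[OF assms] G_transpose[OF assms] by (metis matrix_transpose_mul transpose_mat)
  then have "transpose (H p) ** (G p ** H p) = H p" by (simp add: matrix_mul_assoc)
  then show ?thesis by (simp add: GH assms)
qed

lemma ginv_sym: "p \<in> fst c \<Longrightarrow> ginv g c p i j = ginv g c p j i"
  using H_transpose[of p] by (simp add: vec_eq_iff transpose_def)

lemma mat_smooth_G: "mat_smooth G"
  by (simp add: mat_smooth_def g_smooth)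

lemma mat_smooth_conn: "mat_smooth (\<omega> i)"
  by (simp add: mat_smooth_def conn_mat_def D_smooth)

lemmas G_differentiable = mat_smooth_differentiable[OF mat_smooth_G]
lemmas conn_differentiable = mat_smooth_differentiable[OF mat_smooth_conn]
lemmas curv_differentiable = mat_differentiable_curv_mat[OF mat_smooth_conn]

text \<open>Cramer's rule presents a component of the inverse metric as a quotient of determinants,
  which are polynomials in the components of \<open>g\<close>.\<close>

lemma ginv_differentiable:
  assumes p: "p \<in> fst c"
  shows "chart_differentiable c (\<lambda>q. ginv g c q i j) p"
proof -
  \<comment> \<open>Column \<open>i\<close> of the metric is replaced by the basis vector
    \<open>axis j 1\<close>.\<close>
  let ?N = "\<lambda>q. \<chi> a b. if b = i then axis j 1 $ a else g c q a b"
  have eq: "det (?N q) / det (G q) = ginv g c q i j" if "q \<in> fst c" for q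
  proof -
    have "G q *v (H q *v axis j 1) = axis j 1" by (simp add: matrix_vector_mul_assoc GH that)
    moreover have "det (G q) \<noteq> 0" using g_invertible[OF that] by (simp add: invertible_det_nz)
    ultimately have "H q *v axis j 1 = (\<chi> k. det (\<chi> a b. if b = k then axis j 1 $ a else G q $ a $ b) / det (G q))"
      by (simp add: cramer)
    then show ?thesis by (simp add: matrix_vector_mul_component vec_eq_iff matrix_vector_mult_basis column_def cong: if_cong)
  qed
  have N: "chart_differentiable c (\<lambda>q. det (?N q)) p"
  proof (rule det_differentiable, unfold mat_differentiable_def, intro allI)
    fix a b
    show "chart_differentiable c (\<lambda>q. ?N q $ a $ b) p"
      using chart_smooth_differentiable[OF g_smooth p] by (cases "b = i") simp_all
  qed
  have "det (G p) \<noteq> 0" using g_invertible[OF p] by (simp add: invertible_det_nz)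
  then have "chart_differentiable c (\<lambda>q. det (?N q) / det (G q)) p"
    using N det_differentiable[OF G_differentiable[OF p]]
    unfolding chart_differentiable_def
    by (auto simp: coord_expr_def comp_def p inj_chart intro!: differentiable_divide)
  then show ?thesis by (rule chart_differentiable_cong[OF p eq, rotated])
qed

lemma H_differentiable: "p \<in> fst c \<Longrightarrow> mat_differentiable c H p"
  by (simp add: mat_differentiable_def ginv_differentiable)

lemma partial_G:
  assumes "p \<in> fst c"
  shows "mat_partial c i G p = \<omega> i p ** G p + G p ** transpose (\<omega> i p)"
proof -
  have "nabla_form D c i G p = 0"
    using D_metric[OF assms] by (simp add: cov_deriv_eq_nabla_form vec_eq_iff)
  then show ?thesis by (simp add: nabla_form_def algebra_simps)
qed

text \<open>Differentiating \<open>H q ** G q = mat 1\<close> expresses the derivative of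
  \<open>H\<close> through that of \<open>G\<close>, which \<open>partial_G\<close>
  provides.\<close>

lemma partial_H:
  assumes p: "p \<in> fst c"
  shows "mat_partial c i H p = - (H p ** \<omega> i p) - transpose (\<omega> i p) ** H p"
proof -
  have "mat_partial c i (\<lambda>q. H q ** G q) p = mat_partial c i (\<lambda>q. mat 1) p"
    by (rule mat_partial_cong[OF p]) (rule HG)
  also have "\<dots> = 0" by (simp add: mat_partial_def vec_eq_iff)
  finally have "mat_partial c i H p ** G p + H p ** mat_partial c i G p = 0"
    by (simp add: mat_partial_mult p H_differentiable G_differentiable)
  then have "mat_partial c i H p ** G p ** H p = - (H p ** mat_partial c i G p ** H p)"
    by (metis (no_types, lifting) add_eq_0_iff2 matrix_add_rdistrib times0_left)
  then show ?thesis
    by (simp add: partial_G p matrix_ring_simps HG flip: matrix_mul_assoc)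
      (simp add: GH p matrix_mul_assoc HG)
qed


section \<open>Symmetries of the Levi-Civita curvature\<close>

lemma curv_skew:
  assumes p: "p \<in> fst c"
  shows "transpose (F i j p ** G p) = - (F i j p ** G p)"
proof -
  let ?d = "mat_partial c"
  \<comment> \<open>Two uses of \<open>partial_G\<close> express the second derivatives of the
    metric. Their symmetry in \<open>i\<close>, \<open>j\<close> then says that the lowered
    curvature plus its transpose vanishes.\<close>
  have dd: "?d i (?d j G) p = ?d i (\<omega> j) p ** G p + \<omega> j p ** (\<omega> i p ** G p + G p ** transpose (\<omega> i p))
    + ((\<omega> i p ** G p + G p ** transpose (\<omega> i p)) ** transpose (\<omega> j p) + G p ** transpose (?d i (\<omega> j) p))" for i j
  proof -
    have "?d i (?d j G) p = ?d i (\<lambda>q. \<omega> j q ** G q + G q ** transpose (\<omega> j q)) p"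
      by (rule mat_partial_cong[OF p]) (rule partial_G)
    then show ?thesis
      by (simp add: mat_partial_add mat_partial_mult mat_partial_transpose mat_differentiable_intros
          p G_differentiable conn_differentiable partial_G)
  qed
  have "?d i (?d j G) p = ?d j (?d i G) p"
    by (rule mat_partial_commute[OF mat_smooth_G p])
  then have "F i j p ** G p + G p ** transpose (F i j p) = 0"
    by (simp add: dd curv_mat_eq matrix_ring_simps matrix_transpose_mul transpose_matrix_add
        transpose_matrix_diff algebra_simps)
  then show ?thesis
    by (simp add: matrix_transpose_mul G_transpose p eq_neg_iff_add_eq_0 add.commute)
qed

lemma partial_D_sym: "p \<in> fst c \<Longrightarrow> chart_partial c i (\<lambda>q. D c q j k l) p = chart_partial c i (\<lambda>q. D c q k j l) p"
  by (rule chart_partial_cong) (auto simp: D_sym)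

lemma first_bianchi:
  assumes p: "p \<in> fst c"
  shows "curvature D c p i j k l + curvature D c p j k i l + curvature D c p k i j l = 0"
  using partial_D_sym[OF p, of i j k l] partial_D_sym[OF p, of j k i l] partial_D_sym[OF p, of k i j l]
  by (simp add: curvature_def D_sym[OF p, of j k] D_sym[OF p, of i k] D_sym[OF p, of i j])

text \<open>Lowering an index makes the curvature skew, and the trace of a skew form against the
  symmetric \<open>H\<close> is zero.\<close>

lemma trace_curv: 
  assumes p: "p \<in> fst c" shows "trace (F i j p) = 0"
proof -
  have "trace (F i j p) = trace (transpose (F i j p ** G p) ** H p)"
  proof -
    have "trace (transpose (F i j p ** G p) ** H p) = trace (G p ** transpose (F i j p) ** H p)"
      by (simp add: matrix_transpose_mul G_transpose p)
    also have "\<dots> = trace (transpose (F i j p) ** (H p ** G p))"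
      by (metis matrix_mul_assoc trace_mul_sym)
    finally show ?thesis by (simp add: HG p trace_def transpose_def)
  qed
  also have "\<dots> = - trace (F i j p ** (G p ** H p))"
    by (simp add: curv_skew p matrix_mul_assoc matrix_minus_left trace_minus)
  finally show ?thesis by (simp add: GH p)
qed

text \<open>Contracting the first Bianchi identity leaves the difference of the two Ricci components
  and the trace of the curvature, which vanishes by \<open>trace_curv\<close>.\<close>

lemma ricci_sym:
  assumes p: "p \<in> fst c" shows "ricci D c p i j = ricci D c p j i"
proof -
  have "(\<Sum>l\<in>UNIV. curvature D c p i j l l + curvature D c p j l i l + curvature D c p l i j l) = 0"
    by (simp add: first_bianchi[OF p])
  moreover have "(\<Sum>l\<in>UNIV. curvature D c p i j l l) = 0"
    using trace_curv[OF p, of i j] by (simp add: trace_def curv_mat_def)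
  moreover have "curvature D c p j l i l = - curvature D c p l j i l" for l
    by (simp add: curvature_def)
  ultimately show ?thesis by (simp add: ricci_def sum.distrib sum_subtractf)
qed

text \<open>\<open>nabla_curv_low i j k p $ l $ m\<close> is \<open>D\<^sub>iR\<^sub>j\<^sub>k\<^sub>l\<^sub>m\<close>.\<close>

definition nabla_curv_low :: "'n \<Rightarrow> 'n \<Rightarrow> 'n \<Rightarrow> 'a \<Rightarrow> real^'n^'n" where
  "nabla_curv_low i j k p = nabla_form D c i (\<lambda>q. F j k q ** G q) p
     - (\<Sum>a\<in>UNIV. D c p i j a *\<^sub>R (F a k p ** G p)) - (\<Sum>a\<in>UNIV. D c p i k a *\<^sub>R (F j a p ** G p))"

text \<open>Lowering an index commutes with the covariant derivative: the derivative of
  \<open>G\<close> turns the connection terms of an upper index into those of a lower one.\<close>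

lemma nabla_form_lower:
  assumes p: "p \<in> fst c" and Y: "mat_differentiable c Y p"
  shows "nabla_form D c i (\<lambda>q. Y q ** G q) p = nabla_end D c i Y p ** G p"
  by (simp add: nabla_form_def nabla_end_def mat_partial_mult p Y G_differentiable partial_G matrix_ring_simps)

lemma nabla_curv_low_eq:
  assumes p: "p \<in> fst c"
  shows "nabla_curv_low i j k p = nabla_end D c i (F j k) p ** G p
     - (\<Sum>a\<in>UNIV. D c p i j a *\<^sub>R (F a k p ** G p)) - (\<Sum>a\<in>UNIV. D c p i k a *\<^sub>R (F j a p ** G p))"
  by (simp add: nabla_curv_low_def nabla_form_lower[OF p curv_differentiable[OF p]])

lemma nabla_curv_low_antisym:
  assumes p: "p \<in> fst c"
  shows "nabla_curv_low i j k p = - nabla_curv_low i k j p"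
proof -
  have F: "F j k q = (-1) *\<^sub>R F k j q" for j k q
    using curv_mat_antisym[of D c j k q] by simp
  have "nabla_end D c i (F j k) p = nabla_end D c i (\<lambda>q. (-1) *\<^sub>R F k j q) p"
    by (simp only: F[of j k, abs_def])
  also have "\<dots> = - nabla_end D c i (F k j) p"
    unfolding nabla_end_def mat_partial_scaleR[OF p curv_differentiable[OF p]] by (simp add: matrix_minus_left matrix_minus_right)
  finally have "nabla_end D c i (F j k) p = (-1) *\<^sub>R nabla_end D c i (F k j) p" by simp
  then show ?thesis
    unfolding nabla_curv_low_eq[OF p] F[of _ k] F[of j]
    by (simp add: matrix_minus_left sum_negf)
qed

lemma nabla_curv_low_skew:
  assumes p: "p \<in> fst c"
  shows "nabla_curv_low i j k p $ l $ m = - nabla_curv_low i j k p $ m $ l"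
proof -
  let ?Y = "\<lambda>j k q. F j k q ** G q"
  have Y: "transpose (?Y j k q) = - ?Y j k q" if "q \<in> fst c" for j k q
    by (simp add: curv_skew that)
  have dY: "mat_differentiable c (?Y j k) p" for j k
    by (intro mat_differentiable_mult curv_differentiable G_differentiable p)
  have "transpose (mat_partial c i (?Y j k) p) = mat_partial c i (\<lambda>q. (-1) *\<^sub>R ?Y j k q) p"
    unfolding mat_partial_transpose[symmetric] by (rule mat_partial_cong[OF p]) (simp add: Y)
  also have "\<dots> = (-1) *\<^sub>R mat_partial c i (?Y j k) p"
    by (rule mat_partial_scaleR[OF p dY])
  finally have "transpose (mat_partial c i (?Y j k) p) = - mat_partial c i (?Y j k) p" by simp
  from nabla_form_skew[where Y = "?Y j k", OF this] Y[OF p]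
  have "transpose (nabla_form D c i (?Y j k) p) = - nabla_form D c i (?Y j k) p" by simp
  from skew_matrix_component[OF this, of l m] skew_matrix_component[OF Y[OF p], of _ _ l m]
  show ?thesis by (simp add: nabla_curv_low_def sum_negf)
qed

text \<open>Passing from \<open>second_bianchi_end\<close> to full covariant derivatives adds
  Christoffel terms for the form indices. They cancel in pairs, by symmetry of \<open>D\<close> and
  antisymmetry of the curvature.\<close>

lemma second_bianchi:
  assumes p: "p \<in> fst c"
  shows "nabla_curv_low i j k p + nabla_curv_low j k i p + nabla_curv_low k i j p = 0"
proof -
  have "nabla_end D c i (F j k) p ** G p + nabla_end D c j (F k i) p ** G p + nabla_end D c k (F i j) p ** G p = 0"
    unfolding matrix_add_rdistrib[symmetric] second_bianchi_end[OF mat_smooth_conn p] by simp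
  moreover have "(\<Sum>a\<in>UNIV. D c p i j a *\<^sub>R (F k a p ** G p)) = - (\<Sum>a\<in>UNIV. D c p j i a *\<^sub>R (F a k p ** G p))" for i j k
    unfolding D_sym[OF p, of i j] curv_mat_antisym[of D c k]
    by (simp add: sum_negf[symmetric]) (simp add: vec_eq_iff matrix_matrix_mult_def sum_negf)
  ultimately show ?thesis by (simp add: nabla_curv_low_eq[OF p] algebra_simps)
qed

section \<open>Contractions of the covariant derivative of the curvature\<close>

lemma cov_deriv_ricci:
  assumes p: "p \<in> fst c"
  shows "cov_deriv D (ricci D) c p k j l = (\<Sum>m\<in>UNIV. \<Sum>q\<in>UNIV. ginv g c p q m * nabla_curv_low k m j p $ l $ q)"
proof -
  have "(\<Sum>q\<in>UNIV. ginv g c p q m * nabla_curv_low k m j p $ l $ q) = (nabla_curv_low k m j p ** H p) $ l $ m" for m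
    by (simp add: matrix_matrix_mult_def mult.commute)
  also have "nabla_curv_low k m j p ** H p = nabla_end D c k (F m j) p
     - (\<Sum>a\<in>UNIV. D c p k m a *\<^sub>R F a j p) - (\<Sum>a\<in>UNIV. D c p k j a *\<^sub>R F m a p)" for m
  proof -
    have "nabla_curv_low k m j p = (nabla_end D c k (F m j) p
     - (\<Sum>a\<in>UNIV. D c p k m a *\<^sub>R F a j p) - (\<Sum>a\<in>UNIV. D c p k j a *\<^sub>R F m a p)) ** G p"
      by (simp add: nabla_curv_low_eq[OF p] matrix_ring_simps matrix_sum_rdistrib)
    then show ?thesis by (simp add: GH p flip: matrix_mul_assoc)
  qed
  finally have *: "(\<Sum>q\<in>UNIV. ginv g c p q m * nabla_curv_low k m j p $ l $ q) = (nabla_end D c k (F m j) p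
     - (\<Sum>a\<in>UNIV. D c p k m a *\<^sub>R F a j p) - (\<Sum>a\<in>UNIV. D c p k j a *\<^sub>R F m a p)) $ l $ m" for m .
  \<comment> \<open>These are the connection terms of the upper and of the lower contracted index;
    they carry opposite signs, so the trace commutes with the covariant derivative.\<close>
  have "(\<Sum>m\<in>UNIV. \<Sum>a\<in>UNIV. curvature D c p m j l a * D c p k a m) = (\<Sum>m\<in>UNIV. \<Sum>a\<in>UNIV. D c p k m a * curvature D c p a j l m)"
    by (subst sum.swap) (simp add: mult.commute)
  moreover have "chart_partial c k (\<lambda>q. ricci D c q j l) p = (\<Sum>m\<in>UNIV. chart_partial c k (\<lambda>q. curvature D c q m j l m) p)"
    unfolding ricci_def using curv_differentiable[OF p]
    by (intro chart_partial_sum) (simp add: mat_differentiable_def curv_mat_def)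
  moreover have "(\<Sum>a\<in>UNIV. D c p k x a * ricci D c p y a) = (\<Sum>m\<in>UNIV. \<Sum>a\<in>UNIV. D c p k x a * curvature D c p m y a m)"
    "(\<Sum>a\<in>UNIV. D c p k x a * ricci D c p a y) = (\<Sum>m\<in>UNIV. \<Sum>a\<in>UNIV. D c p k x a * curvature D c p m a y m)" for x y
    unfolding ricci_def sum_distrib_left by (rule sum.swap)+
  ultimately show ?thesis
    unfolding * by (simp add: cov_deriv_def nabla_end_def curv_mat_def conn_mat_def mat_partial_def
        matrix_matrix_mult_def sum.distrib sum_subtractf)
qed

text \<open>The metric is parallel, so its inverse passes through the derivative: the two terms of
  \<open>partial_H\<close> become the two connection terms of \<open>T\<close> under the
  trace.\<close>

lemma trace_cov_deriv:
  assumes p: "p \<in> fst c" and T: "\<And>a b. chart_differentiable c (\<lambda>q. T c q a b) p"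
  shows "(\<Sum>j\<in>UNIV. \<Sum>l\<in>UNIV. ginv g c p j l * cov_deriv D T c p i j l)
    = chart_partial c i (\<lambda>q. \<Sum>j\<in>UNIV. \<Sum>l\<in>UNIV. ginv g c q j l * T c q j l) p"
proof -
  let ?T = "\<lambda>q. \<chi> a b. T c q a b"
  have T': "mat_differentiable c ?T p" by (simp add: mat_differentiable_def T)
  have "chart_partial c i (\<lambda>q. \<Sum>j\<in>UNIV. \<Sum>l\<in>UNIV. ginv g c q j l * T c q j l) p
      = chart_partial c i (\<lambda>q. trace (H q ** ?T q)) p"
  proof (rule chart_partial_cong[OF p])
    fix q assume "q \<in> fst c"
    from trace_mult_sym[of "H q" "?T q"] ginv_sym[OF this]
    show "(\<Sum>j\<in>UNIV. \<Sum>l\<in>UNIV. ginv g c q j l * T c q j l) = trace (H q ** ?T q)" by simp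
  qed
  also have "\<dots> = trace (mat_partial c i H p ** ?T p + H p ** mat_partial c i ?T p)"
    by (simp add: chart_partial_trace mat_differentiable_mult H_differentiable p T' mat_partial_mult)
  also have "\<dots> = trace (H p ** mat_partial c i ?T p) - trace (H p ** \<omega> i p ** ?T p) - trace (transpose (\<omega> i p) ** H p ** ?T p)"
    by (simp add: partial_H p matrix_ring_simps trace_add trace_sub)
      (simp add: trace_def matrix_matrix_mult_def sum_negf)
  also have "trace (transpose (\<omega> i p) ** H p ** ?T p) = trace (H p ** ?T p ** transpose (\<omega> i p))"
    by (metis matrix_mul_assoc trace_mul_sym)
  also have "trace (H p ** mat_partial c i ?T p) - trace (H p ** \<omega> i p ** ?T p) - trace (H p ** ?T p ** transpose (\<omega> i p))
      = trace (H p ** nabla_form D c i ?T p)"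
    by (simp add: nabla_form_def matrix_ring_simps trace_sub)
  also have "\<dots> = (\<Sum>j\<in>UNIV. \<Sum>l\<in>UNIV. ginv g c p j l * cov_deriv D T c p i j l)"
    using trace_mult_sym[of "H p" "nabla_form D c i ?T p"] ginv_sym[OF p] by (simp add: cov_deriv_eq_nabla_form)
  finally show ?thesis ..
qed

lemma ricci_differentiable:
  assumes "p \<in> fst c" shows "chart_differentiable c (\<lambda>q. ricci D c q i j) p"
  unfolding ricci_def using curv_differentiable[OF assms]
  by (intro chart_differentiable_sum) (simp add: mat_differentiable_def curv_mat_def)

lemma scalar_differentiable:
  assumes "p \<in> fst c" shows "chart_differentiable c (scalar_curvature g D c) p"
  unfolding scalar_curvature_def[abs_def]
  by (intro chart_differentiable_sum chart_differentiable_mult ricci_differentiable ginv_differentiable assms)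

lemma d_scalar_eq:
  assumes "p \<in> fst c"
  shows "d_scalar g D c p k = (\<Sum>j\<in>UNIV. \<Sum>l\<in>UNIV. ginv g c p j l * cov_deriv D (ricci D) c p k j l)"
  unfolding d_scalar_def scalar_curvature_def[abs_def]
  by (rule trace_cov_deriv[symmetric]) (intro assms ricci_differentiable)+

text \<open>The second Bianchi identity is contracted twice. One of its three terms gives the
  differential of the scalar curvature, the other two give minus the divergence each.\<close>

lemma contracted_bianchi:
  assumes p: "p \<in> fst c"
  shows "2 * divergence g D (ricci D) c p k = d_scalar g D c p k"
proof -
  let ?h = "ginv g c p" and ?B = "\<lambda>i j k l m. nabla_curv_low i j k p $ l $ m"
  let ?S = "\<lambda>f :: 'n \<Rightarrow> 'n \<Rightarrow> 'n \<Rightarrow> 'n \<Rightarrow> real. \<Sum>j\<in>UNIV. \<Sum>l\<in>UNIV. \<Sum>m\<in>UNIV. \<Sum>q\<in>UNIV. ?h j l * ?h m q * f j l m q"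
  have ds: "d_scalar g D c p k = ?S (\<lambda>j l m q. ?B k m j l q)"
    by (simp add: d_scalar_eq p cov_deriv_ricci sum_distrib_left mult.assoc ginv_sym[OF p])
  have div: "divergence g D (ricci D) c p k = ?S (\<lambda>j l m q. ?B j m k l q)"
    by (simp add: divergence_def p cov_deriv_ricci sum_distrib_left mult.assoc ginv_sym[OF p])
  \<comment> \<open>Skewness in the last pair, followed by exchanging the two contracted pairs
    (\<open>j\<close>, \<open>l\<close>) and (\<open>m\<close>, \<open>q\<close>), produces the
    divergence.\<close>
  have "?S (\<lambda>j l m q. ?B m j k l q) = - ?S (\<lambda>j l m q. ?B m j k q l)"
    by (subst nabla_curv_low_skew[OF p]) (simp add: sum_negf)
  also have "?S (\<lambda>j l m q. ?B m j k q l) = divergence g D (ricci D) c p k"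
    unfolding div by (subst sum_pairs_swap) (simp add: mult.commute)
  finally have 2: "?S (\<lambda>j l m q. ?B m j k l q) = - divergence g D (ricci D) c p k" .
  have 3: "?S (\<lambda>j l m q. ?B j k m l q) = - divergence g D (ricci D) c p k"
    unfolding div by (subst nabla_curv_low_antisym[OF p]) (simp add: sum_negf)
  have "?B k m j l q + ?B m j k l q + ?B j k m l q = 0" for j l m q
    using second_bianchi[OF p, of k m j] by (metis vector_add_component zero_index)
  then have "?S (\<lambda>j l m q. ?B k m j l q + ?B m j k l q + ?B j k m l q) = 0" by simp
  then have "?S (\<lambda>j l m q. ?B k m j l q) + ?S (\<lambda>j l m q. ?B m j k l q) + ?S (\<lambda>j l m q. ?B j k m l q) = 0"
    by (simp only: distrib_left sum.distrib)
  then show ?thesis using ds 2 3 by simp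
qed

lemma divergence_cong:
  assumes "p \<in> fst c" "\<And>q i j. q \<in> fst c \<Longrightarrow> T c q i j = U c q i j"
  shows "divergence g D T c p i = divergence g D U c p i"
proof -
  have "chart_partial c i (\<lambda>q. T c q j k) p = chart_partial c i (\<lambda>q. U c q j k) p" for i j k
    by (rule chart_partial_cong) (use assms in auto)
  then show ?thesis using assms by (simp add: divergence_def cov_deriv_def)
qed

lemma sum_ginv_g: "p \<in> fst c \<Longrightarrow> (\<Sum>b\<in>UNIV. ginv g c p a b * g c p b e) = (if a = e then 1 else 0)"
  using HG[of p] by (simp add: vec_eq_iff matrix_matrix_mult_def mat_def)

lemma cov_deriv_scaled_metric:
  assumes p: "p \<in> fst c" and T: "\<And>a b. chart_differentiable c (\<lambda>q. T c q a b) p"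
    and \<phi>: "chart_differentiable c \<phi> p"
  shows "cov_deriv D (\<lambda>c q i j. r * T c q i j + \<phi> q * g c q i j) c p i j k
    = r * cov_deriv D T c p i j k + chart_partial c i \<phi> p * g c p j k"
proof -
  have g: "chart_differentiable c (\<lambda>q. g c q a b) p" for a b
    by (rule chart_smooth_differentiable[OF g_smooth p])
  have "cov_deriv D (\<lambda>c q i j. r * T c q i j + \<phi> q * g c q i j) c p i j k
    = r * cov_deriv D T c p i j k + chart_partial c i \<phi> p * g c p j k + \<phi> p * cov_deriv D g c p i j k"
    by (simp add: cov_deriv_def chart_partial_add chart_differentiable_mult T \<phi> g chart_partial_cmult
        chart_partial_times p sum.distrib distrib_left right_diff_distrib sum_distrib_left mult.left_commute)
  then show ?thesis by (simp add: D_metric p)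
qed

text \<open>Used with \<open>r = 4\<close> and the Ricci tensor, and with \<open>r = 1\<close> and
  \<open>LL\<close>: the two presentations of the stress-energy tensor whose divergences are
  compared.\<close>

lemma divergence_scaled_metric:
  assumes p: "p \<in> fst c" and T: "\<And>a b. chart_differentiable c (\<lambda>q. T c q a b) p"
    and \<phi>: "chart_differentiable c \<phi> p"
  shows "divergence g D (\<lambda>c q i j. r * T c q i j + \<phi> q * g c q i j) c p i
    = r * divergence g D T c p i + chart_partial c i \<phi> p"
proof -
  have "(\<Sum>a\<in>UNIV. \<Sum>b\<in>UNIV. ginv g c p a b * (chart_partial c a \<phi> p * g c p i b))
      = (\<Sum>a\<in>UNIV. chart_partial c a \<phi> p * (\<Sum>b\<in>UNIV. ginv g c p a b * g c p b i))"
    by (simp add: sum_distrib_left mult.left_commute g_sym[OF p, of i])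
  also have "\<dots> = chart_partial c i \<phi> p"
    by (simp add: sum_ginv_g p if_distrib cong: if_cong)
  finally show ?thesis
    by (simp add: divergence_def cov_deriv_scaled_metric[where T = T and \<phi> = \<phi>, OF assms] distrib_left sum.distrib
        sum_distrib_left mult.left_commute)
qed

end

section \<open>Statistical structures in a chart\<close>

locale statistical_chart = levi_civita_chart c g D
  for c :: "('a, 'n::finite) chart" and g :: "('a, 'n) comp2" and D :: "('a, 'n) comp3" +
  fixes \<Gamma> :: "('a, 'n) comp3"
  assumes \<Gamma>_smooth: "chart_smooth (\<lambda>p. \<Gamma> c p i j k)"
    and \<Gamma>_sym: "p \<in> fst c \<Longrightarrow> \<Gamma> c p i j k = \<Gamma> c p j i k"
    and cubic_sym12: "p \<in> fst c \<Longrightarrow> cubic_form \<Gamma> g c p i j k = cubic_form \<Gamma> g c p j i k"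
    and cubic_trace: "p \<in> fst c \<Longrightarrow> (\<Sum>a\<in>UNIV. \<Sum>b\<in>UNIV. ginv g c p a b * cubic_form \<Gamma> g c p i a b) = 0"
begin

abbreviation "L \<equiv> cubic_form \<Gamma> g c"
abbreviation "Lm i p \<equiv> (\<chi> j k. L p i j k)"

definition M :: "'n \<Rightarrow> 'a \<Rightarrow> real^'n^'n" where
  "M i p = (\<chi> j k. cubic_form_up \<Gamma> g c p i j k)"

lemma cubic_sym23:
  assumes p: "p \<in> fst c" shows "L p i j k = L p i k j"
proof -
  have "chart_partial c i (\<lambda>q. g c q j k) p = chart_partial c i (\<lambda>q. g c q k j) p"
    by (rule chart_partial_cong[OF p]) (rule g_sym)
  then show ?thesis by (simp add: cubic_form_def cov_deriv_def g_sym[OF p, of j] g_sym[OF p, of k])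
qed

lemma cubic_sym13: "p \<in> fst c \<Longrightarrow> L p i j k = L p k j i"
  using cubic_sym12 cubic_sym23 by metis

lemma M_eq: "M i p = Lm i p ** H p"
  by (simp add: M_def cubic_form_up_def matrix_matrix_mult_def vec_eq_iff)

lemma M_G: "p \<in> fst c \<Longrightarrow> M i p ** G p = Lm i p"
  by (simp add: M_eq HG flip: matrix_mul_assoc)

lemma Lm_eq: "Lm i p = nabla_form \<Gamma> c i G p"
  by (simp add: vec_eq_iff cubic_form_def cov_deriv_eq_nabla_form)

text \<open>Koszul's argument for the lowered difference \<open>?S\<close> of the two connections:
  torsion-freeness makes it symmetric in the first two indices, and its symmetrization in the last
  two is the cubic form.\<close>

lemma conn_mat_eq:
  assumes p: "p \<in> fst c"
  shows "\<omega> i p = conn_mat \<Gamma> c i p + (1/2) *\<^sub>R M i p"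
proof -
  let ?S = "\<lambda>i. (\<omega> i p - conn_mat \<Gamma> c i p) ** G p"
  have "Lm i p = ?S i + transpose (?S i)" for i
    unfolding Lm_eq nabla_form_def partial_G[OF p]
    by (simp add: matrix_ring_simps matrix_transpose_mul transpose_matrix_diff G_transpose p)
  then have L: "L p i j k = ?S i $ j $ k + ?S i $ k $ j" for i j k
    by (simp add: vec_eq_iff transpose_def)
  have S: "?S i $ j $ k = ?S j $ i $ k" for i j k
    by (simp add: matrix_matrix_mult_def conn_mat_def D_sym[OF p, of i] \<Gamma>_sym[OF p, of i])
  \<comment> \<open>In this alternating sum all other components of \<open>?S\<close> cancel by
    \<open>S\<close>; total symmetry of \<open>L\<close> then reduces the right-hand side to one
    term.\<close>
  have "2 * ?S i $ j $ k = L p i j k + L p j i k - L p k i j" for i j k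
    using L[of i j k] L[of j i k] L[of k i j] S[of i j k] S[of i k j] S[of j k i] by linarith
  then have "2 * ?S i $ j $ k = L p i j k" for i j k
    using cubic_sym12[OF p] cubic_sym13[OF p] cubic_sym23[OF p] by (metis add_diff_cancel_right')
  then have "Lm i p = 2 *\<^sub>R ?S i" by (simp add: vec_eq_iff)
  then have "M i p = 2 *\<^sub>R (\<omega> i p - conn_mat \<Gamma> c i p)"
    by (simp add: M_eq matrix_scaleR_mult GH p flip: matrix_mul_assoc)
  then show ?thesis by simp
qed

lemma conn_mat_conjugate:
  assumes p: "p \<in> fst c"
  shows "conn_mat (conjugate \<Gamma> g) c i p = conn_mat \<Gamma> c i p + M i p"
  by (simp add: vec_eq_iff conn_mat_def conjugate_def M_eq matrix_matrix_mult_def cubic_form_def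
      mult.commute ginv_sym[OF p])

lemma mat_smooth_conn_\<Gamma>: "mat_smooth (conn_mat \<Gamma> c i)"
  by (simp add: mat_smooth_def conn_mat_def \<Gamma>_smooth)

text \<open>\<open>M\<close> is twice the difference of two smooth connection forms, so nothing in
  the formula for the cubic form has to be differentiated.\<close>

lemma M_differentiable:
  assumes p: "p \<in> fst c" shows "mat_differentiable c (M i) p"
proof -
  have "mat_differentiable c (\<lambda>q. 2 *\<^sub>R (\<omega> i q - conn_mat \<Gamma> c i q)) p"
    by (intro mat_differentiable_intros mat_smooth_differentiable mat_smooth_conn mat_smooth_conn_\<Gamma> p)
  then have "chart_differentiable c (\<lambda>q. (2 *\<^sub>R (\<omega> i q - conn_mat \<Gamma> c i q)) $ k $ l) p" for k l
    unfolding mat_differentiable_def by blast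
  then have "chart_differentiable c (\<lambda>q. M i q $ k $ l) p" for k l
    by (rule chart_differentiable_cong[OF p, rotated]) (simp add: conn_mat_eq)
  then show ?thesis by (simp add: mat_differentiable_def)
qed

text \<open>The curvature along the line of connections through \<open>D\<close> in the direction
  \<open>M\<close>. The value \<open>t = -1/2\<close> is the given connection,
  \<open>t = 1/2\<close> its conjugate.\<close>

lemma curv_mat_deformed:
  assumes p: "p \<in> fst c" and E: "\<And>i q. q \<in> fst c \<Longrightarrow> conn_mat E c i q = \<omega> i q + t *\<^sub>R M i q"
  shows "curv_mat E c i j p = F i j p + t *\<^sub>R (nabla_end D c i (M j) p - nabla_end D c j (M i) p)
    + t\<^sup>2 *\<^sub>R (M j p ** M i p - M i p ** M j p)"
proof -
  have "mat_partial c i (conn_mat E c j) p = mat_partial c i (\<omega> j) p + t *\<^sub>R mat_partial c i (M j) p" for i j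
  proof -
    have "mat_partial c i (conn_mat E c j) p = mat_partial c i (\<lambda>q. \<omega> j q + t *\<^sub>R M j q) p"
      by (rule mat_partial_cong[OF p]) (rule E)
    then show ?thesis
      by (simp add: mat_partial_add mat_partial_scaleR p conn_differentiable M_differentiable mat_differentiable_intros)
  qed
  then show ?thesis
    by (simp add: curv_mat_eq E p nabla_end_def matrix_ring_simps algebra_simps power2_eq_square)
qed

text \<open>The components \<open>D\<^sub>iL\<^sub>j\<^sub>k\<^sub>l\<close>, and \<open>D\<^sub>iL\<^sub>j\<^sub>k\<^sup>l\<close> below.\<close>

definition DL :: "'n \<Rightarrow> 'n \<Rightarrow> 'a \<Rightarrow> real^'n^'n" where
  "DL i j p = nabla_form D c i (Lm j) p - (\<Sum>a\<in>UNIV. D c p i j a *\<^sub>R Lm a p)"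

definition DM :: "'n \<Rightarrow> 'n \<Rightarrow> 'a \<Rightarrow> real^'n^'n" where
  "DM i j p = nabla_end D c i (M j) p - (\<Sum>a\<in>UNIV. D c p i j a *\<^sub>R M a p)"

lemma DM_eq:
  assumes p: "p \<in> fst c" shows "DM i j p = DL i j p ** H p"
proof -
  have "nabla_form D c i (Lm j) p = nabla_form D c i (\<lambda>q. M j q ** G q) p"
    unfolding nabla_form_def M_G[OF p] using mat_partial_cong[OF p, of "Lm j" "\<lambda>q. M j q ** G q"]
    by (simp add: M_G)
  also have "\<dots> = nabla_end D c i (M j) p ** G p"
    by (rule nabla_form_lower[OF p M_differentiable[OF p]])
  finally have "DL i j p = DM i j p ** G p"
    by (simp add: DL_def DM_def matrix_ring_simps matrix_sum_rdistrib M_G p)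
  then show ?thesis by (simp add: GH p flip: matrix_mul_assoc)
qed

lemma DL_component:
  "DL i j p $ k $ l = chart_partial c i (\<lambda>q. L q j k l) p - (\<Sum>a\<in>UNIV. D c p i k a * L p j a l)
     - (\<Sum>a\<in>UNIV. D c p i l a * L p j k a) - (\<Sum>a\<in>UNIV. D c p i j a * L p a k l)"
  by (simp add: DL_def nabla_form_def mat_partial_def conn_mat_def transpose_def matrix_matrix_mult_def mult.commute)

lemma DL_sym:
  assumes p: "p \<in> fst c"
  shows "DL i j p $ k $ l = DL i k p $ j $ l" and "DL i j p $ k $ l = DL i j p $ l $ k"
proof -
  have "chart_partial c i (\<lambda>q. L q j k l) p = chart_partial c i (\<lambda>q. L q k j l) p"
    by (rule chart_partial_cong[OF p]) (rule cubic_sym12)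
  then show "DL i j p $ k $ l = DL i k p $ j $ l"
    by (simp add: DL_component cubic_sym12[OF p, of j _ l] cubic_sym12[OF p, of k _ l] cubic_sym12[OF p, of j k])
  have "chart_partial c i (\<lambda>q. L q j k l) p = chart_partial c i (\<lambda>q. L q j l k) p"
    by (rule chart_partial_cong[OF p]) (rule cubic_sym23)
  then show "DL i j p $ k $ l = DL i j p $ l $ k"
    by (simp add: DL_component cubic_sym23[OF p, of j _ l] cubic_sym23[OF p, of j k] cubic_sym23[OF p, of _ k l])
qed

end

text \<open>\<open>H p ** Y ** H p\<close> is \<open>Y\<close> with both indices raised, so the sum
  is the metric pairing of two bilinear forms; as a trace it can be rearranged cyclically.\<close>

lemma (in levi_civita_chart) sum_pairing_eq_trace:
  assumes p: "p \<in> fst c"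
  shows "(\<Sum>j\<in>UNIV. \<Sum>k\<in>UNIV. (H p ** Y ** H p) $ j $ k * Z $ j $ k) = trace (transpose Y ** H p ** Z ** H p)"
proof -
  have "(\<Sum>j\<in>UNIV. \<Sum>k\<in>UNIV. (H p ** Y ** H p) $ j $ k * Z $ j $ k) = trace (transpose (H p ** Y ** H p) ** Z)"
    by (subst sum.swap) (simp add: trace_def matrix_matrix_mult_def transpose_def)
  also have "\<dots> = trace (H p ** (transpose Y ** H p ** Z))"
    by (simp add: matrix_transpose_mul H_transpose p matrix_mul_assoc)
  also have "\<dots> = trace (transpose Y ** H p ** Z ** H p)" by (rule trace_mul_sym)
  finally show ?thesis .
qed

context statistical_chart
begin

lemma trace_M:
  assumes p: "p \<in> fst c" shows "trace (M j p) = 0"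
  using cubic_trace[OF p, of j]
  by (simp add: trace_def M_eq matrix_matrix_mult_def mult.commute ginv_sym[OF p])

lemma M_sym: "p \<in> fst c \<Longrightarrow> M i p $ j $ k = M j p $ i $ k"
  by (simp add: M_eq matrix_matrix_mult_def cubic_sym12)

lemma contract_M:
  assumes p: "p \<in> fst c" shows "(\<Sum>m\<in>UNIV. M m p $ a $ m) = 0"
  using trace_M[OF p, of a] by (simp add: trace_def M_sym[OF p, of _ a])

lemma trace_DM:
  assumes p: "p \<in> fst c" shows "trace (DM i j p) = 0"
proof -
  have "trace (mat_partial c i (M j) p) = chart_partial c i (\<lambda>q. trace (M j q)) p"
    by (rule chart_partial_trace[OF M_differentiable[OF p], symmetric])
  also have "\<dots> = chart_partial c i (\<lambda>q. 0) p"
    by (rule chart_partial_cong[OF p]) (rule trace_M)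
  finally have "trace (nabla_end D c i (M j) p) = 0"
    by (simp add: nabla_end_def trace_add trace_sub trace_mul_sym[of "M j p"])
  then show ?thesis by (simp add: DM_def trace_sub trace_sum_scaleR trace_M p)
qed

lemma DM_component: "p \<in> fst c \<Longrightarrow> DM i j p $ k $ l = (\<Sum>q\<in>UNIV. DL i j p $ k $ q * ginv g c p q l)"
  by (simp add: DM_eq matrix_matrix_mult_def)

lemma contract_DM:
  assumes p: "p \<in> fst c" shows "(\<Sum>m\<in>UNIV. DM i m p $ j $ m) = 0"
  using trace_DM[OF p, of i j]
  by (simp add: trace_def DM_component[OF p] DL_sym(1)[OF p, of i _ j])

section \<open>Ricci tensors of the deformed connections\<close>

definition div_L :: "'n \<Rightarrow> 'n \<Rightarrow> 'a \<Rightarrow> real" where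
  "div_L i j p = (\<Sum>m\<in>UNIV. DM m i p $ j $ m)"

definition LL :: "'n \<Rightarrow> 'n \<Rightarrow> 'a \<Rightarrow> real" where
  "LL i j p = trace (M i p ** M j p)"

lemma div_L_sym: "p \<in> fst c \<Longrightarrow> div_L i j p = div_L j i p"
  by (simp add: div_L_def DM_component DL_sym(1)[of p _ i j])

lemma LL_sym: "LL i j p = LL j i p"
  unfolding LL_def by (rule trace_mul_sym)

text \<open>The Christoffel terms that \<open>nabla_end\<close> omits for the form index are
  symmetric in \<open>i\<close>, \<open>j\<close>, since \<open>D\<close> is torsion-free.\<close>

lemma nabla_end_M_alt:
  assumes p: "p \<in> fst c"
  shows "nabla_end D c i (M j) p - nabla_end D c j (M i) p = DM i j p - DM j i p"
  by (simp add: DM_def D_sym[OF p, of i j])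

lemma ricci_deformed:
  assumes p: "p \<in> fst c" and E: "\<And>i q. q \<in> fst c \<Longrightarrow> conn_mat E c i q = \<omega> i q + t *\<^sub>R M i q"
  shows "ricci E c p i j = ricci D c p i j + t * div_L i j p - t\<^sup>2 * LL i j p"
proof -
  \<comment> \<open>The inner sum is the trace of the cubic form, hence this quadratic term drops
    out.\<close>
  have "(\<Sum>m\<in>UNIV. (M i p ** M m p) $ j $ m) = (\<Sum>a\<in>UNIV. M i p $ j $ a * (\<Sum>m\<in>UNIV. M m p $ a $ m))"
    unfolding matrix_matrix_mult_def by (simp add: sum_distrib_left) (rule sum.swap)
  then have 1: "(\<Sum>m\<in>UNIV. (M i p ** M m p) $ j $ m) = 0" by (simp add: contract_M p)
  \<comment> \<open>Exchanging the form index with the row index turns this contraction into an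
    honest trace.\<close>
  have "(\<Sum>m\<in>UNIV. (M m p ** M i p) $ j $ m) = (\<Sum>m\<in>UNIV. (M j p ** M i p) $ m $ m)"
    by (simp add: matrix_matrix_mult_def M_sym[OF p, of _ j])
  then have 2: "(\<Sum>m\<in>UNIV. (M m p ** M i p) $ j $ m) = LL j i p"
    by (simp add: LL_def trace_def)
  have "ricci E c p i j = (\<Sum>m\<in>UNIV. curv_mat E c m i p $ j $ m)" by (simp add: ricci_def curv_mat_def)
  also have "\<dots> = (\<Sum>m\<in>UNIV. F m i p $ j $ m) + t * ((\<Sum>m\<in>UNIV. DM m i p $ j $ m) - (\<Sum>m\<in>UNIV. DM i m p $ j $ m))
      + t\<^sup>2 * ((\<Sum>m\<in>UNIV. (M i p ** M m p) $ j $ m) - (\<Sum>m\<in>UNIV. (M m p ** M i p) $ j $ m))"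
    by (simp add: curv_mat_deformed[OF p E] nabla_end_M_alt[OF p] sum.distrib sum_subtractf
        flip: sum_distrib_left)
  finally show ?thesis
    by (simp add: 1 2 LL_sym[of j] contract_DM[OF p] div_L_def ricci_def curv_mat_def)
qed

lemma ricci_\<Gamma>:
  "p \<in> fst c \<Longrightarrow> ricci \<Gamma> c p i j = ricci D c p i j - (1/2) * div_L i j p - (1/4) * LL i j p"
  using ricci_deformed[of p \<Gamma> "-1/2" i j] by (simp add: conn_mat_eq power2_eq_square)

lemma ricci_conjugate:
  "p \<in> fst c \<Longrightarrow> ricci (conjugate \<Gamma> g) c p i j = ricci D c p i j + (1/2) * div_L i j p - (1/4) * LL i j p"
  using ricci_deformed[of p "conjugate \<Gamma> g" "1/2" i j]
  by (simp add: conn_mat_eq conn_mat_conjugate power2_eq_square scaleR_left_distrib[symmetric])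

section \<open>The norm of the cubic form and its stress-energy tensor\<close>

definition N :: "'a \<Rightarrow> real" where
  "N p = (\<Sum>i\<in>UNIV. \<Sum>j\<in>UNIV. ginv g c p i j * LL i j p)"

lemma raise_last_two:
  assumes p: "p \<in> fst c"
  shows "(\<Sum>b\<in>UNIV. \<Sum>e\<in>UNIV. ginv g c p j b * ginv g c p k e * L p a b e) = (H p ** Lm a p ** H p) $ j $ k"
  by (subst sum.swap) (simp add: matrix_matrix_mult_def sum_distrib_right sum_distrib_left
      mult_ac ginv_sym[OF p, of k])

lemma cubic_form_upup_eq:
  assumes p: "p \<in> fst c"
  shows "cubic_form_upup \<Gamma> g c p i j k = (\<Sum>a\<in>UNIV. ginv g c p i a * (H p ** Lm a p ** H p) $ j $ k)"
  unfolding raise_last_two[OF p, symmetric] cubic_form_upup_def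
  by (simp add: sum_distrib_left mult.assoc)

lemma Lm_transpose: "p \<in> fst c \<Longrightarrow> transpose (Lm a p) = Lm a p"
  by (simp add: vec_eq_iff transpose_def cubic_sym23)

lemma pairing_Lm:
  assumes p: "p \<in> fst c"
  shows "(\<Sum>j\<in>UNIV. \<Sum>k\<in>UNIV. (H p ** Lm a p ** H p) $ j $ k * Z $ j $ k) = trace (M a p ** Z ** H p)"
  by (simp add: sum_pairing_eq_trace p Lm_transpose M_eq)

text \<open>Summing over the last two indices at once regroups the norm as the metric trace of
  \<open>LL\<close>, a form to which \<open>trace_cov_deriv\<close> applies.\<close>

lemma cubic_form_sqnorm_eq:
  assumes p: "p \<in> fst c" shows "cubic_form_sqnorm \<Gamma> g c p = N p"
proof -
  have "cubic_form_sqnorm \<Gamma> g c p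
      = (\<Sum>i\<in>UNIV. \<Sum>j\<in>UNIV. \<Sum>k\<in>UNIV. \<Sum>a\<in>UNIV. ginv g c p i a * ((H p ** Lm a p ** H p) $ j $ k * Lm i p $ j $ k))"
    by (simp add: cubic_form_sqnorm_def cubic_form_upup_eq[OF p] sum_distrib_right mult.assoc)
  also have "\<dots> = (\<Sum>i\<in>UNIV. \<Sum>a\<in>UNIV. ginv g c p i a * (\<Sum>j\<in>UNIV. \<Sum>k\<in>UNIV. (H p ** Lm a p ** H p) $ j $ k * Lm i p $ j $ k))"
    unfolding sum_distrib_left by (intro sum.cong refl sum_rotate)
  also have "\<dots> = (\<Sum>i\<in>UNIV. \<Sum>a\<in>UNIV. ginv g c p i a * LL a i p)"
    unfolding pairing_Lm[OF p] by (simp add: LL_def M_eq[symmetric] flip: matrix_mul_assoc)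
  also have "\<dots> = N p" by (simp add: N_def LL_sym)
  finally show ?thesis .
qed

lemma stress_energy_eq:
  "p \<in> fst c \<Longrightarrow> stress_energy \<Gamma> g c p i j = LL i j p - (1/2) * N p * g c p i j"
  by (simp add: stress_energy_def cubic_form_sqnorm_eq LL_def trace_def matrix_matrix_mult_def M_def)

lemma LL_differentiable:
  assumes p: "p \<in> fst c" shows "chart_differentiable c (LL i j) p"
proof -
  have "mat_differentiable c (\<lambda>q. M i q ** M j q) p"
    by (intro mat_differentiable_mult M_differentiable p)
  then show ?thesis unfolding LL_def trace_def mat_differentiable_def
    by (intro chart_differentiable_sum) simp
qed

lemma N_differentiable: "p \<in> fst c \<Longrightarrow> chart_differentiable c N p"
  unfolding N_def[abs_def]
  by (intro chart_differentiable_sum chart_differentiable_mult ginv_differentiable LL_differentiable)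

text \<open>This is the Leibniz rule. The connection terms of the two endomorphism indices cancel by
  cyclicity of the trace, those of the form indices are absorbed into \<open>DM\<close>.\<close>

lemma cov_deriv_LL:
  assumes p: "p \<in> fst c"
  shows "cov_deriv D (\<lambda>c q i j. LL i j q) c p k i j = trace (DM k i p ** M j p) + trace (M i p ** DM k j p)"
proof -
  have "chart_partial c k (LL i j) p
      = trace (mat_partial c k (M i) p ** M j p + M i p ** mat_partial c k (M j) p)"
    unfolding LL_def
    by (simp add: chart_partial_trace mat_differentiable_mult M_differentiable p mat_partial_mult)
  also have "\<dots> = trace (nabla_end D c k (M i) p ** M j p) + trace (M i p ** nabla_end D c k (M j) p)
      + trace (\<omega> k p ** (M i p ** M j p)) - trace (M i p ** M j p ** \<omega> k p)"
    by (simp add: nabla_end_def matrix_ring_simps trace_add trace_sub)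
  also have "trace (\<omega> k p ** (M i p ** M j p)) = trace (M i p ** M j p ** \<omega> k p)" by (rule trace_mul_sym)
  finally have 1: "chart_partial c k (LL i j) p = trace (nabla_end D c k (M i) p ** M j p) + trace (M i p ** nabla_end D c k (M j) p)"
    by simp
  have tr: "trace ((\<Sum>a\<in>UNIV. x a *\<^sub>R M a p) ** Y) = (\<Sum>a\<in>UNIV. x a * trace (M a p ** Y))" for x Y
    by (simp add: matrix_sum_rdistrib matrix_scaleR_mult trace_sum_scaleR)
  show ?thesis
    by (simp add: cov_deriv_def 1 DM_def matrix_ring_simps trace_sub tr trace_mul_sym[of "M i p" "\<Sum>a\<in>UNIV. D c p k j a *\<^sub>R M a p"])
      (simp add: LL_def trace_mul_sym[of _ "M i p"])
qed

lemma partial_N: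
  assumes p: "p \<in> fst c"
  shows "chart_partial c i N p = 2 * (\<Sum>a\<in>UNIV. \<Sum>b\<in>UNIV. ginv g c p a b * trace (DM i a p ** M b p))"
proof -
  have "chart_partial c i N p = (\<Sum>a\<in>UNIV. \<Sum>b\<in>UNIV. ginv g c p a b * cov_deriv D (\<lambda>c q i j. LL i j q) c p i a b)"
    unfolding N_def[abs_def]
    by (subst trace_cov_deriv[OF p]) (rule LL_differentiable[OF p], rule refl)
  also have "\<dots> = (\<Sum>a\<in>UNIV. \<Sum>b\<in>UNIV. ginv g c p a b * trace (DM i a p ** M b p))
      + (\<Sum>a\<in>UNIV. \<Sum>b\<in>UNIV. ginv g c p a b * trace (M a p ** DM i b p))"
    by (simp add: cov_deriv_LL p distrib_left sum.distrib)
  also have "(\<Sum>a\<in>UNIV. \<Sum>b\<in>UNIV. ginv g c p a b * trace (M a p ** DM i b p))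
      = (\<Sum>a\<in>UNIV. \<Sum>b\<in>UNIV. ginv g c p a b * trace (DM i a p ** M b p))"
    by (subst sum.swap) (simp add: ginv_sym[OF p] trace_mul_sym[of _ "DM _ _ _"])
  finally show ?thesis by simp
qed

lemma cubic_form_upup_sym:
  assumes p: "p \<in> fst c"
  shows "cubic_form_upup \<Gamma> g c p i j k = cubic_form_upup \<Gamma> g c p j i k"
    and "cubic_form_upup \<Gamma> g c p i j k = cubic_form_upup \<Gamma> g c p i k j"
proof -
  have "cubic_form_upup \<Gamma> g c p i j k = (\<Sum>b\<in>UNIV. \<Sum>a\<in>UNIV. \<Sum>e\<in>UNIV.
      ginv g c p i a * ginv g c p j b * ginv g c p k e * cubic_form \<Gamma> g c p a b e)"
    unfolding cubic_form_upup_def by (rule sum.swap)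
  also have "\<dots> = cubic_form_upup \<Gamma> g c p j i k"
    unfolding cubic_form_upup_def
    by (intro sum.cong refl) (simp add: cubic_sym12[OF p])
  finally show "cubic_form_upup \<Gamma> g c p i j k = cubic_form_upup \<Gamma> g c p j i k" .
  have "cubic_form_upup \<Gamma> g c p i j k = (\<Sum>a\<in>UNIV. \<Sum>e\<in>UNIV. \<Sum>b\<in>UNIV.
      ginv g c p i a * ginv g c p j b * ginv g c p k e * cubic_form \<Gamma> g c p a b e)"
    unfolding cubic_form_upup_def by (intro sum.cong refl sum.swap)
  also have "\<dots> = cubic_form_upup \<Gamma> g c p i k j"
    unfolding cubic_form_upup_def
    by (intro sum.cong refl) (simp add: cubic_sym23[OF p])
  finally show "cubic_form_upup \<Gamma> g c p i j k = cubic_form_upup \<Gamma> g c p i k j" .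
qed

lemma cubic_form_dot_curvature_eq_trace:
  assumes p: "p \<in> fst c"
  shows "cubic_form_dot_curvature \<Gamma> g c p i
    = (\<Sum>a\<in>UNIV. \<Sum>j\<in>UNIV. ginv g c p a j * trace (M j p ** curv_mat \<Gamma> c i a p))"
proof -
  let ?R = "\<lambda>a. curv_mat \<Gamma> c i a p ** G p"
  have R: "curvature_low g \<Gamma> c p i a b e = ?R a $ b $ e" for a b e
    by (simp add: curvature_low_def curv_mat_def matrix_matrix_mult_def)
  have "cubic_form_dot_curvature \<Gamma> g c p i
      = (\<Sum>a\<in>UNIV. \<Sum>b\<in>UNIV. \<Sum>e\<in>UNIV. cubic_form_upup \<Gamma> g c p a b e * curvature_low g \<Gamma> c p i a b e)"
    unfolding cubic_form_dot_curvature_def by (rule sum_sym3) (rule cubic_form_upup_sym[OF p])+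
  also have "\<dots> = (\<Sum>a\<in>UNIV. \<Sum>b\<in>UNIV. \<Sum>e\<in>UNIV. \<Sum>j\<in>UNIV.
      ginv g c p a j * ((H p ** Lm j p ** H p) $ b $ e * ?R a $ b $ e))"
    by (simp add: cubic_form_upup_eq[OF p] R sum_distrib_right mult.assoc)
  also have "\<dots> = (\<Sum>a\<in>UNIV. \<Sum>j\<in>UNIV. ginv g c p a j *
      (\<Sum>b\<in>UNIV. \<Sum>e\<in>UNIV. (H p ** Lm j p ** H p) $ b $ e * ?R a $ b $ e))"
    unfolding sum_distrib_left by (intro sum.cong refl sum_rotate)
  also have "\<dots> = (\<Sum>a\<in>UNIV. \<Sum>j\<in>UNIV. ginv g c p a j * trace (M j p ** curv_mat \<Gamma> c i a p))"
    unfolding pairing_Lm[OF p] by (simp add: GH p flip: matrix_mul_assoc)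
  finally show ?thesis .
qed

text \<open>The trace of a product of a self-adjoint and a skew-adjoint endomorphism vanishes.\<close>

lemma trace_M_curv:
  assumes p: "p \<in> fst c" shows "trace (M j p ** F i a p) = 0"
proof -
  let ?K = "F i a p ** G p"
  have F: "F i a p = ?K ** H p" by (simp add: GH p flip: matrix_mul_assoc)
  have eq: "trace (M j p ** F i a p) = trace (Lm j p ** H p ** ?K ** H p)"
    using arg_cong[OF F, of "\<lambda>Y. trace (M j p ** Y)"] by (simp only: M_eq matrix_mul_assoc)
  also have "\<dots> = trace (transpose (Lm j p ** H p ** ?K ** H p))"
    by (simp add: trace_def transpose_def)
  also have "\<dots> = trace (H p ** (transpose ?K ** H p ** Lm j p))"
    by (simp only: matrix_transpose_mul H_transpose[OF p] Lm_transpose[OF p] matrix_mul_assoc)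
  also have "\<dots> = - trace (H p ** ?K ** H p ** Lm j p)"
    by (simp only: curv_skew[OF p] matrix_minus_left matrix_minus_right trace_minus matrix_mul_assoc)
  also have "trace (H p ** ?K ** H p ** Lm j p) = trace (Lm j p ** (H p ** ?K ** H p))"
    by (rule trace_mul_sym)
  also have "\<dots> = trace (Lm j p ** H p ** ?K ** H p)" by (simp only: matrix_mul_assoc)
  finally show ?thesis using eq by simp
qed

text \<open>The curvature of \<open>D\<close> is skew and contributes nothing against the symmetric
  \<open>L\<close>. The first-order part of the deformation at \<open>t = -1/2\<close> remains, and
  \<open>partial_N\<close> turns half of it into the differential of the norm.\<close>

lemma cubic_form_dot_curvature_eq:
  assumes p: "p \<in> fst c"
  shows "cubic_form_dot_curvature \<Gamma> g c p i
    = (1/2) * (\<Sum>a\<in>UNIV. \<Sum>j\<in>UNIV. ginv g c p a j * trace (DM a i p ** M j p))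
      - (1/4) * chart_partial c i N p"
proof -
  let ?h = "ginv g c p"
  have R: "curv_mat \<Gamma> c i a p = F i a p - (1/2) *\<^sub>R (DM i a p - DM a i p)
      + (1/4) *\<^sub>R (M a p ** M i p - M i p ** M a p)" for a
    using curv_mat_deformed[OF p, of \<Gamma> "-1/2" i a]
    by (simp add: conn_mat_eq nabla_end_M_alt[OF p] power2_eq_square)
  \<comment> \<open>The cubic terms cancel: symmetry of \<open>?h\<close> exchanges \<open>a\<close>
    and \<open>j\<close>, and a cyclic shift identifies the two traces.\<close>
  have "(\<Sum>a\<in>UNIV. \<Sum>j\<in>UNIV. ?h a j * trace (M j p ** M a p ** M i p))
      = (\<Sum>a\<in>UNIV. \<Sum>j\<in>UNIV. ?h a j * trace (M a p ** M j p ** M i p))"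
    by (subst sum.swap) (simp add: ginv_sym[OF p])
  moreover have "trace (M j p ** M i p ** M a p) = trace (M a p ** M j p ** M i p)" for j a
    using trace_mul_sym[of "M j p ** M i p" "M a p"] by (simp add: matrix_mul_assoc)
  ultimately have 0: "(\<Sum>a\<in>UNIV. \<Sum>j\<in>UNIV. ?h a j * (trace (M j p ** M a p ** M i p) - trace (M j p ** M i p ** M a p))) = 0"
    by (simp add: right_diff_distrib sum_subtractf)
  have "?h a j * trace (M j p ** curv_mat \<Gamma> c i a p)
      = (1/2) * (?h a j * trace (DM a i p ** M j p)) - (1/2) * (?h a j * trace (DM i a p ** M j p))
        + (1/4) * (?h a j * (trace (M j p ** M a p ** M i p) - trace (M j p ** M i p ** M a p)))" for a j
    by (simp add: R matrix_ring_simps trace_add trace_sub trace_M_curv p trace_scaleR trace_mul_sym[of "M j p" "DM _ _ p"] algebra_simps)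
  then have "cubic_form_dot_curvature \<Gamma> g c p i
      = (1/2) * (\<Sum>a\<in>UNIV. \<Sum>j\<in>UNIV. ?h a j * trace (DM a i p ** M j p))
        - (1/2) * (\<Sum>a\<in>UNIV. \<Sum>j\<in>UNIV. ?h a j * trace (DM i a p ** M j p))
        + (1/4) * (\<Sum>a\<in>UNIV. \<Sum>j\<in>UNIV. ?h a j * (trace (M j p ** M a p ** M i p) - trace (M j p ** M i p ** M a p)))"
    unfolding cubic_form_dot_curvature_eq_trace[OF p] sum_distrib_left
    by (simp only: sum.distrib sum_subtractf)
  then show ?thesis by (simp only: 0 partial_N[OF p])
qed

end

section \<open>Consequences of the naive Einstein condition\<close>

locale naive_einstein_chart = statistical_chart c g D \<Gamma>
  for c :: "('a, 'n::finite) chart" and g :: "('a, 'n) comp2" and D \<Gamma> :: "('a, 'n) comp3" +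
  assumes naive: "p \<in> fst c \<Longrightarrow> (1/2) * (ricci \<Gamma> c p i j + ricci \<Gamma> c p j i)
       = scalar_curvature g \<Gamma> c p / real CARD('n) * g c p i j"
    and naive_conjugate: "p \<in> fst c \<Longrightarrow>
       (1/2) * (ricci (conjugate \<Gamma> g) c p i j + ricci (conjugate \<Gamma> g) c p j i)
       = scalar_curvature g \<Gamma> c p / real CARD('n) * g c p i j"
begin

abbreviation "s \<equiv> scalar_curvature g \<Gamma> c"

text \<open>The two symmetrized Ricci tensors agree and differ by \<open>div_L\<close>.\<close>

lemma div_L_zero: "p \<in> fst c \<Longrightarrow> div_L i j p = 0"
  using naive[of p i j] naive_conjugate[of p i j]
  by (simp add: ricci_\<Gamma> ricci_conjugate ricci_sym[of p j i] div_L_sym[of p j i] LL_sym[of j i])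

lemma ricci_D_eq: "p \<in> fst c \<Longrightarrow> ricci D c p i j = (1/4) * LL i j p + s p / real CARD('n) * g c p i j"
  using naive[of p i j] div_L_zero[of p]
  by (simp add: ricci_\<Gamma> ricci_sym[of p j i] LL_sym[of j i])

lemma trace_metric:
  assumes p: "p \<in> fst c" shows "(\<Sum>i\<in>UNIV. \<Sum>j\<in>UNIV. ginv g c p i j * g c p i j) = real CARD('n)"
proof -
  have "(\<Sum>j\<in>UNIV. ginv g c p i j * g c p i j) = 1" for i
    using sum_ginv_g[OF p, of i i] by (simp add: g_sym[OF p, of i])
  then show ?thesis by simp
qed

lemma scalar_D_eq:
  assumes p: "p \<in> fst c" shows "scalar_curvature g D c p = (1/4) * N p + s p"
proof -
  have "scalar_curvature g D c p = (1/4) * N p + s p / real CARD('n) * (\<Sum>i\<in>UNIV. \<Sum>j\<in>UNIV. ginv g c p i j * g c p i j)"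
    unfolding scalar_curvature_def[of g D] ricci_D_eq[OF p] N_def
    by (simp add: distrib_left sum.distrib sum_distrib_left mult.left_commute)
  then show ?thesis by (simp add: trace_metric p)
qed

lemma s_differentiable:
  assumes p: "p \<in> fst c" shows "chart_differentiable c s p"
proof -
  have "chart_differentiable c (\<lambda>q. scalar_curvature g D c q - (1/4) * N q) p"
    by (intro chart_differentiable_diff chart_differentiable_mult chart_differentiable_const
        scalar_differentiable N_differentiable p)
  then show ?thesis by (rule chart_differentiable_cong[OF p, rotated]) (simp add: scalar_D_eq)
qed

text \<open>The coefficient of \<open>g\<close> is 1/n - 1/2, from the trace-free and the trace part
  of the Ricci tensor; the norm in \<open>scalar_D_eq\<close> completes \<open>LL\<close> to the
  stress-energy tensor.\<close>

lemma einstein_tensor_eq: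
  assumes p: "p \<in> fst c"
  shows "einstein_tensor g D c p i j = (1/4) * stress_energy \<Gamma> g c p i j - (real CARD('n) - 2) / (2 * real CARD('n)) * s p * g c p i j"
  by (simp add: einstein_tensor_def stress_energy_eq ricci_D_eq scalar_D_eq p field_simps)

lemma divergence_stress_energy:
  assumes p: "p \<in> fst c"
  shows "real CARD('n) * divergence g D (stress_energy \<Gamma> g) c p i = 2 * (real CARD('n) - 2) * d_scalar g \<Gamma> c p i"
proof -
  \<comment> \<open>Solving \<open>einstein_tensor_eq\<close> for the stress-energy tensor gives
    four times the Ricci tensor plus this multiple of \<open>g\<close>. Its second summand cancels
    the divergence of the Ricci part by \<open>contracted_bianchi\<close>.\<close>
  let ?\<phi> = "\<lambda>q. (2 * (real CARD('n) - 2) / real CARD('n)) * s q - 2 * scalar_curvature g D c q"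
  have \<phi>: "chart_differentiable c ?\<phi> p"
    by (intro chart_differentiable_diff chart_differentiable_mult chart_differentiable_const
        scalar_differentiable s_differentiable p)
  have "divergence g D (stress_energy \<Gamma> g) c p i = divergence g D (\<lambda>c q i j. 4 * ricci D c q i j + ?\<phi> q * g c q i j) c p i"
  proof (rule divergence_cong[OF p])
    fix q i j assume q: "q \<in> fst c"
    have "4 * ricci D c q i j = 4 * einstein_tensor g D c q i j + 2 * scalar_curvature g D c q * g c q i j"
      by (simp add: einstein_tensor_def)
    then show "stress_energy \<Gamma> g c q i j = 4 * ricci D c q i j + ?\<phi> q * g c q i j"
      by (simp add: einstein_tensor_eq[OF q] field_simps)
  qed
  also have "\<dots> = 4 * divergence g D (ricci D) c p i + chart_partial c i ?\<phi> p"
    by (rule divergence_scaled_metric[where T = "ricci D" and \<phi> = ?\<phi>, OF p ricci_differentiable[OF p] \<phi>])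
  also have "chart_partial c i ?\<phi> p = (2 * (real CARD('n) - 2) / real CARD('n)) * d_scalar g \<Gamma> c p i - 2 * d_scalar g D c p i"
    unfolding d_scalar_def chart_partial_cmult[OF p s_differentiable[OF p], symmetric]
      chart_partial_cmult[OF p scalar_differentiable[OF p], symmetric]
    by (intro chart_partial_diff p chart_differentiable_mult chart_differentiable_const
        s_differentiable scalar_differentiable)
  finally show ?thesis by (simp add: contracted_bianchi[OF p, symmetric] field_simps)
qed

text \<open>By symmetry of the last three indices of \<open>DL\<close> the derivative may be
  contracted with any of them, so this is \<open>div_L\<close> with an index raised.\<close>

lemma ginv_contract_DM:
  assumes p: "p \<in> fst c"
  shows "(\<Sum>a\<in>UNIV. \<Sum>b\<in>UNIV. ginv g c p a b *\<^sub>R DM a b p) = 0"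
proof -
  have DL: "DL a b p $ k $ q = DL a k p $ q $ b" for a b k q
    using DL_sym[OF p] by metis
  have "(\<Sum>a\<in>UNIV. \<Sum>b\<in>UNIV. ginv g c p a b * DM a b p $ k $ l)
      = (\<Sum>q\<in>UNIV. ginv g c p q l * div_L k q p)" for k l
  proof -
    have "(\<Sum>a\<in>UNIV. \<Sum>b\<in>UNIV. ginv g c p a b * DM a b p $ k $ l)
        = (\<Sum>a\<in>UNIV. \<Sum>b\<in>UNIV. \<Sum>q\<in>UNIV. ginv g c p q l * (DL a k p $ q $ b * ginv g c p b a))"
      by (simp add: DM_component[OF p] DL[of _ _ k] sum_distrib_left ginv_sym[OF p] mult_ac)
    also have "\<dots> = (\<Sum>q\<in>UNIV. ginv g c p q l * div_L k q p)"
      unfolding div_L_def DM_component[OF p] sum_distrib_left by (rule sum_rotate)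
    finally show ?thesis .
  qed
  then show ?thesis by (simp add: vec_eq_iff div_L_zero p)
qed

text \<open>Of the two terms in the divergence of \<open>LL\<close> the one containing the
  divergence of the cubic form vanishes; what remains, less half the differential of
  \<open>N\<close>, is twice \<open>cubic_form_dot_curvature_eq\<close>.\<close>

lemma divergence_stress_energy_eq_dot_curvature:
  assumes p: "p \<in> fst c"
  shows "divergence g D (stress_energy \<Gamma> g) c p i = 2 * cubic_form_dot_curvature \<Gamma> g c p i"
proof -
  let ?\<phi> = "\<lambda>q. (-1/2) * N q"
  have \<phi>: "chart_differentiable c ?\<phi> p"
    by (intro chart_differentiable_mult chart_differentiable_const N_differentiable p)
  \<comment> \<open>\<open>LL\<close> and \<open>N\<close> belong to the fixed chart
    \<open>c\<close>. Ignoring \<open>c'\<close> is harmless, as the divergence at \<open>c\<close>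
    reads the tensor only in \<open>c\<close>.\<close>
  have "divergence g D (stress_energy \<Gamma> g) c p i = divergence g D (\<lambda>c' q i j. 1 * LL i j q + ?\<phi> q * g c' q i j) c p i"
    by (rule divergence_cong[OF p]) (simp add: stress_energy_eq)
  also have "\<dots> = 1 * divergence g D (\<lambda>c q i j. LL i j q) c p i + chart_partial c i ?\<phi> p"
    by (rule divergence_scaled_metric[where T = "\<lambda>c q i j. LL i j q" and \<phi> = ?\<phi>, OF p LL_differentiable[OF p] \<phi>])
  also have "chart_partial c i ?\<phi> p = (-1/2) * chart_partial c i N p"
    by (rule chart_partial_cmult[OF p N_differentiable[OF p]])
  also have "divergence g D (\<lambda>c q i j. LL i j q) c p i
      = (\<Sum>a\<in>UNIV. \<Sum>b\<in>UNIV. ginv g c p a b * trace (DM a i p ** M b p))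
        + (\<Sum>a\<in>UNIV. \<Sum>b\<in>UNIV. ginv g c p a b * trace (DM a b p ** M i p))"
    by (simp add: divergence_def cov_deriv_LL[OF p] distrib_left sum.distrib trace_mul_sym[of "M i p"])
  also have "(\<Sum>a\<in>UNIV. \<Sum>b\<in>UNIV. ginv g c p a b * trace (DM a b p ** M i p))
      = trace ((\<Sum>a\<in>UNIV. \<Sum>b\<in>UNIV. ginv g c p a b *\<^sub>R DM a b p) ** M i p)"
    by (simp add: matrix_sum_rdistrib matrix_scaleR_mult trace_sum trace_scaleR)
  also have "\<dots> = 0" by (simp add: ginv_contract_DM[OF p] trace_def)
  finally show ?thesis by (simp add: cubic_form_dot_curvature_eq[OF p])
qed

end

lemma chart_domainI:
  assumes "is_chart X c" "openin X V" "V \<subseteq> fst c"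
  shows "chart_domain c V"
proof
  have top: "topspace (subtopology X (fst c)) = fst c"
    using assms(1) by (auto simp: is_chart_def dest: openin_subset)
  show "inj_on (snd c) (fst c)"
    using assms(1) homeomorphic_imp_injective_map top unfolding is_chart_def by metis
  have "open_map (subtopology X (fst c)) (top_of_set (chart_image c)) (snd c)"
    using assms(1) homeomorphic_imp_open_map unfolding is_chart_def by blast
  moreover have "openin (subtopology X (fst c)) V"
    using assms(2,3) by (auto simp: openin_subtopology)
  ultimately have "openin (top_of_set (chart_image c)) (snd c ` V)"
    unfolding open_map_def by blast
  then show "open (snd c ` V)"
    using assms(1) openin_open_eq unfolding is_chart_def by blast
qed (rule assms(3))

section \<open>Change of chart\<close>

locale chart_overlap =
  fixes c d :: "('a, 'n::finite) chart" and V :: "'a set"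
  assumes V_def: "V = fst c \<inter> fst d"
    and c_domain: "chart_domain c V" and d_domain: "chart_domain d V"
    and cd_smooth: "\<And>m. smooth_on (snd c ` V) (coord_expr c (\<lambda>p. snd d p $ m))"
    and dc_smooth: "\<And>m. smooth_on (snd d ` V) (coord_expr d (\<lambda>p. snd c p $ m))"

sublocale chart_overlap \<subseteq> chart_domain c V by (rule c_domain)

context chart_overlap
begin

abbreviation "J p \<equiv> (\<chi> i m. jacobian c d p i m)"
abbreviation "K p \<equiv> (\<chi> i m. jacobian d c p i m)"

lemma chain_rule:
  assumes p: "p \<in> V" and f: "chart_differentiable d f p"
  shows "chart_differentiable c f p"
    and "chart_partial c i f p = (\<Sum>a\<in>UNIV. jacobian c d p i a * chart_partial d a f p)"
proof -
  let ?y = "\<lambda>x. snd d (inv_into (fst c) (snd c) x)" and ?x = "snd c p"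
  let ?Y = "\<lambda>m. frechet_derivative (coord_expr c (\<lambda>q. snd d q $ m)) (at ?x)"
  have inv: "inv_into (fst c) (snd c) (snd c q) = q" "inv_into (fst d) (snd d) (snd d q) = q" if "q \<in> V" for q
    using that V_def inj_chart chart_domain.inj_chart[OF d_domain] by auto
  have "((\<lambda>x. ?y x $ m) has_derivative ?Y m) (at ?x)" for m
    using smooth_onD(1)[OF cd_smooth] p frechet_derivative_works
    by (auto simp: coord_expr_def comp_def)
  then have "((\<lambda>x. \<chi> m. ?y x $ m) has_derivative (\<lambda>v. \<chi> m. ?Y m v)) (at ?x)"
    unfolding has_derivative_componentwise_within[where f = "\<lambda>x. \<chi> m. ?y x $ m"]
    by (auto simp: Basis_vec_def inner_axis)
  then have y: "(?y has_derivative (\<lambda>v. \<chi> m. ?Y m v)) (at ?x)" by simp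
  have yp: "?y ?x = snd d p" by (simp add: inv p)
  have f': "(coord_expr d f has_derivative frechet_derivative (coord_expr d f) (at (snd d p))) (at (?y ?x))"
    using f frechet_derivative_works unfolding chart_differentiable_def yp by blast
  let ?F = "\<lambda>v. frechet_derivative (coord_expr d f) (at (snd d p)) (\<chi> m. ?Y m v)"
  have "((\<lambda>x. coord_expr d f (?y x)) has_derivative ?F) (at ?x)"
    by (rule has_derivative_compose[OF y f'])
  \<comment> \<open>\<open>inv_into\<close> is controlled only on the image of the overlap, so the
    two functions are compared on that open set.\<close>
  then have F: "(coord_expr c f has_derivative ?F) (at ?x)"
    by (rule has_derivative_transform_within_open[OF _ open_image])
      (use p in \<open>auto simp: coord_expr_def inv\<close>)
  then show "chart_differentiable c f p"
    unfolding chart_differentiable_def differentiable_def by blast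
  have "chart_partial c i f p = ?F (axis i 1)"
    by (simp add: chart_partial_def partial_deriv_def flip: frechet_derivative_at[OF F])
  also have "\<dots> = (\<Sum>a\<in>UNIV. jacobian c d p i a * chart_partial d a f p)"
    using f by (simp add: frechet_derivative_eq_sum_partial_deriv chart_differentiable_def
        jacobian_def chart_partial_def partial_deriv_def)
  finally show "chart_partial c i f p = (\<Sum>a\<in>UNIV. jacobian c d p i a * chart_partial d a f p)" .
qed

text \<open>The chain rule for the coordinate functions of \<open>c\<close>, whose derivatives in
  \<open>c\<close> itself are those of the identity.\<close>

lemma JK:
  assumes p: "p \<in> V" shows "J p ** K p = mat 1"
proof -
  have "(\<Sum>a\<in>UNIV. jacobian c d p i a * jacobian d c p a m) = (if i = m then 1 else 0)" for i m
  proof -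
    have "chart_differentiable d (\<lambda>q. snd c q $ m) p"
      using smooth_onD(1)[OF dc_smooth] p by (auto simp: chart_differentiable_def)
    from chain_rule(2)[OF p this]
    have "(\<Sum>a\<in>UNIV. jacobian c d p i a * jacobian d c p a m) = chart_partial c i (\<lambda>q. snd c q $ m) p"
      by (simp add: jacobian_def)
    also have "\<dots> = partial_deriv i (\<lambda>x. x $ m) (snd c p)"
      unfolding chart_partial_def
      by (rule partial_deriv_cong[OF open_image]) (use p in \<open>auto simp: coord_expr_apply\<close>)
    also have "\<dots> = axis i 1 $ m"
    proof -
      have "((\<lambda>x :: real^'n. x $ m) has_derivative (\<lambda>v. v $ m)) (at (snd c p))"
        by (rule bounded_linear_imp_has_derivative) (rule bounded_linear_vec_nth)
      from frechet_derivative_at[OF this, symmetric] show ?thesis by (simp add: partial_deriv_def)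
    qed
    finally show ?thesis by (simp add: axis_def)
  qed
  then show ?thesis by (simp add: vec_eq_iff matrix_matrix_mult_def mat_def)
qed

lemma KJ: "p \<in> V \<Longrightarrow> K p ** J p = mat 1"
  using JK matrix_left_right_inverse by blast

lemma smooth_J: "chart_smooth (\<lambda>q. jacobian c d q i m)"
proof -
  have "chart_smooth (\<lambda>q. snd d q $ m)" by (simp add: chart_smooth_def cd_smooth)
  from chart_smooth_partial[OF this] show ?thesis by (simp add: jacobian_def[abs_def])
qed

lemma mat_smooth_J: "mat_smooth J"
  by (simp add: mat_smooth_def smooth_J)

lemma partial_J_sym:
  assumes p: "p \<in> V"
  shows "chart_partial c i (\<lambda>q. jacobian c d q j m) p = chart_partial c j (\<lambda>q. jacobian c d q i m) p"
proof -
  have "chart_smooth (\<lambda>q. snd d q $ m)" by (simp add: chart_smooth_def cd_smooth)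
  from chart_partial_commute[OF this p] show ?thesis by (simp add: jacobian_def[abs_def])
qed

end

locale connection_overlap = chart_overlap c d V
  for c d :: "('a, 'n::finite) chart" and V :: "'a set" +
  fixes \<Gamma> :: "('a, 'n) comp3"
  assumes \<Gamma>_smooth_c: "\<And>i j k. smooth_on (chart_image c) (coord_expr c (\<lambda>p. \<Gamma> c p i j k))"
    and \<Gamma>_smooth_d: "\<And>i j k. smooth_on (chart_image d) (coord_expr d (\<lambda>p. \<Gamma> d p i j k))"
    and \<Gamma>_transform: "\<And>p i j m. p \<in> V \<Longrightarrow> (\<Sum>k\<in>UNIV. \<Gamma> c p i j k * jacobian c d p k m) =
        chart_partial c i (\<lambda>q. jacobian c d q j m) p +
        (\<Sum>a\<in>UNIV. \<Sum>b\<in>UNIV. jacobian c d p i a * jacobian c d p j b * \<Gamma> d p a b m)"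
begin

abbreviation "\<omega> \<equiv> conn_mat \<Gamma> c"
abbreviation "\<omega>' \<equiv> conn_mat \<Gamma> d"

text \<open>The pullback of the connection form of \<open>d\<close> along the change of coordinates.\<close>

definition W :: "'n \<Rightarrow> 'a \<Rightarrow> real^'n^'n" where
  "W i p = (\<Sum>a\<in>UNIV. jacobian c d p i a *\<^sub>R \<omega>' a p)"

text \<open>The transformation law of Christoffel symbols read as a gauge transformation by the
  Jacobian matrix.\<close>

lemma \<omega>_J: "p \<in> V \<Longrightarrow> \<omega> i p ** J p = mat_partial c i J p + J p ** W i p"
proof -
  assume p: "p \<in> V"
  have "(J p ** W i p) $ j $ m = (\<Sum>a\<in>UNIV. \<Sum>b\<in>UNIV. jacobian c d p i a * jacobian c d p j b * \<Gamma> d p a b m)" for j m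
    by (subst sum.swap) (simp add: matrix_matrix_mult_def W_def conn_mat_def sum_distrib_left mult_ac)
  then show ?thesis
    using \<Gamma>_transform[OF p]
    by (simp add: vec_eq_iff) (simp add: matrix_matrix_mult_def conn_mat_def mat_partial_def)
qed

lemma \<omega>_differentiable: "p \<in> V \<Longrightarrow> mat_differentiable c (\<omega> i) p"
  using smooth_onD(1)[OF \<Gamma>_smooth_c] V_def
  by (auto simp: mat_differentiable_def chart_differentiable_def conn_mat_def)

lemma \<omega>'_differentiable_d: "p \<in> V \<Longrightarrow> mat_differentiable d (\<omega>' i) p"
  using smooth_onD(1)[OF \<Gamma>_smooth_d] V_def
  by (auto simp: mat_differentiable_def chart_differentiable_def conn_mat_def)

lemma \<omega>'_differentiable: "p \<in> V \<Longrightarrow> mat_differentiable c (\<omega>' i) p"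
  using \<omega>'_differentiable_d by (auto simp: mat_differentiable_def intro: chain_rule)

lemma partial_\<omega>':
  "p \<in> V \<Longrightarrow> mat_partial c i (\<omega>' a) p = (\<Sum>b\<in>UNIV. jacobian c d p i b *\<^sub>R mat_partial d b (\<omega>' a) p)"
  using \<omega>'_differentiable_d[of p a] by (simp add: vec_eq_iff mat_differentiable_def mat_partial_def chain_rule(2))

lemma W_differentiable:
  assumes p: "p \<in> V" shows "mat_differentiable c (W i) p"
  using \<omega>'_differentiable[OF p] chart_smooth_differentiable[OF smooth_J p]
  by (auto simp: W_def mat_differentiable_def intro!: chart_differentiable_sum chart_differentiable_mult)

lemma partial_W:
  assumes p: "p \<in> V"
  shows "mat_partial c i (W j) p = (\<Sum>a\<in>UNIV. chart_partial c i (\<lambda>q. jacobian c d q j a) p *\<^sub>R \<omega>' a p)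
    + (\<Sum>a\<in>UNIV. \<Sum>b\<in>UNIV. (jacobian c d p j a * jacobian c d p i b) *\<^sub>R mat_partial d b (\<omega>' a) p)"
proof -
  have "mat_partial c i (W j) p = (\<Sum>a\<in>UNIV. chart_partial c i (\<lambda>q. jacobian c d q j a) p *\<^sub>R \<omega>' a p)
    + (\<Sum>a\<in>UNIV. jacobian c d p j a *\<^sub>R mat_partial c i (\<omega>' a) p)"
    using \<omega>'_differentiable[OF p] chart_smooth_differentiable[OF smooth_J p]
    by (simp add: vec_eq_iff mat_partial_def W_def mat_differentiable_def chart_partial_sum
        chart_differentiable_mult chart_partial_times[OF p] sum.distrib)
  then show ?thesis by (simp add: partial_\<omega>' p scaleR_sum_right)
qed

text \<open>Pullback commutes with forming the curvature. The derivatives of the Jacobian are second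
  derivatives of the transition map, symmetric in \<open>i\<close>, \<open>j\<close> by
  \<open>partial_J_sym\<close>, and disappear.\<close>

lemma curvature_W:
  assumes p: "p \<in> V"
  shows "mat_partial c i (W j) p - mat_partial c j (W i) p + W j p ** W i p - W i p ** W j p
    = (\<Sum>a\<in>UNIV. \<Sum>b\<in>UNIV. (jacobian c d p i a * jacobian c d p j b) *\<^sub>R curv_mat \<Gamma> d a b p)"
proof -
  let ?J = "jacobian c d p"
  have W: "W i p ** W j p = (\<Sum>a\<in>UNIV. \<Sum>b\<in>UNIV. (?J i a * ?J j b) *\<^sub>R (\<omega>' a p ** \<omega>' b p))" for i j
    by (simp add: W_def matrix_sum_rdistrib matrix_sum_ldistrib matrix_scaleR_mult matrix_mult_scaleR scaleR_sum_right)
      (subst sum.swap, simp add: mult.commute)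
  have W': "W j p ** W i p = (\<Sum>a\<in>UNIV. \<Sum>b\<in>UNIV. (?J i a * ?J j b) *\<^sub>R (\<omega>' b p ** \<omega>' a p))"
    unfolding W[of j i] by (rule trans[OF sum.swap]) (simp add: mult.commute)
  have d: "(\<Sum>a\<in>UNIV. \<Sum>b\<in>UNIV. (?J j a * ?J i b) *\<^sub>R mat_partial d b (\<omega>' a) p)
      = (\<Sum>a\<in>UNIV. \<Sum>b\<in>UNIV. (?J i a * ?J j b) *\<^sub>R mat_partial d a (\<omega>' b) p)"
    by (subst sum.swap) (simp add: mult.commute)
  show ?thesis
    unfolding partial_W[OF p] d W' W[of i j] partial_J_sym[OF p, of i j]
    by (simp add: curv_mat_eq scaleR_add_right scaleR_diff_right sum.distrib sum_subtractf)
qed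

text \<open>Gauge covariance: \<open>\<omega>_J\<close> is differentiated and antisymmetrized, so
  that second derivatives of \<open>J\<close> cancel, and its remaining first derivatives are
  eliminated by \<open>\<omega>_J\<close> again.\<close>

lemma curvature_transform:
  assumes p: "p \<in> V"
  shows "curv_mat \<Gamma> c i j p ** J p = J p **
    (\<Sum>a\<in>UNIV. \<Sum>b\<in>UNIV. (jacobian c d p i a * jacobian c d p j b) *\<^sub>R curv_mat \<Gamma> d a b p)"
proof -
  let ?d = "mat_partial c"
  note dJ = mat_smooth_differentiable[OF mat_smooth_J p] mat_smooth_differentiable[OF mat_smooth_partial[OF mat_smooth_J] p]
  have 1: "?d i (\<omega> j) p ** J p + \<omega> j p ** ?d i J p = ?d i (?d j J) p + (?d i J p ** W j p + J p ** ?d i (W j) p)" for i j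
  proof -
    have "?d i (\<lambda>q. \<omega> j q ** J q) p = ?d i (\<lambda>q. ?d j J q + J q ** W j q) p"
      by (rule mat_partial_cong[OF p]) (rule \<omega>_J)
    then show ?thesis
      by (simp add: mat_partial_add mat_partial_mult p dJ \<omega>_differentiable W_differentiable mat_differentiable_mult)
  qed
  have 2: "?d i J p = \<omega> i p ** J p - J p ** W i p" for i using \<omega>_J[OF p, of i] by simp
  have 3: "?d i (\<omega> j) p ** J p = ?d i (?d j J) p + ?d i J p ** W j p + J p ** ?d i (W j) p - \<omega> j p ** ?d i J p" for i j
    using 1[of i j] by (simp add: algebra_simps)
  have "curv_mat \<Gamma> c i j p ** J p = J p ** (?d i (W j) p - ?d j (W i) p + W j p ** W i p - W i p ** W j p)"
    by (simp add: curv_mat_eq matrix_add_rdistrib matrix_diff_rdistrib 3 mat_partial_commute[OF mat_smooth_J p, of i j])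
      (simp add: 2 matrix_ring_simps)
  then show ?thesis by (simp only: curvature_W[OF p])
qed

text \<open>The Jacobian of the contracted form index meets the inverse Jacobian of the upper index,
  and \<open>KJ\<close> removes both.\<close>

lemma ricci_transform:
  assumes p: "p \<in> V"
  shows "ricci \<Gamma> c p i j = (\<Sum>a\<in>UNIV. \<Sum>b\<in>UNIV. jacobian c d p i a * jacobian c d p j b * ricci \<Gamma> d p a b)"
proof -
  let ?J = "jacobian c d p" and ?R = "curv_mat \<Gamma> d"
  have R: "curv_mat \<Gamma> c m i p = (\<Sum>a\<in>UNIV. \<Sum>b\<in>UNIV. (?J m a * ?J i b) *\<^sub>R (J p ** ?R a b p ** K p))" for m
  proof -
    have "curv_mat \<Gamma> c m i p = curv_mat \<Gamma> c m i p ** J p ** K p"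
      by (simp add: JK p flip: matrix_mul_assoc)
    then show ?thesis
      by (simp add: curvature_transform p matrix_sum_rdistrib matrix_sum_ldistrib matrix_scaleR_mult matrix_mult_scaleR)
  qed
  have "ricci \<Gamma> c p i j = (\<Sum>m\<in>UNIV. curv_mat \<Gamma> c m i p $ j $ m)"
    by (simp add: ricci_def curv_mat_def)
  also have "\<dots> = (\<Sum>m\<in>UNIV. \<Sum>a\<in>UNIV. \<Sum>b\<in>UNIV. ?J i b * ((J p ** ?R a b p ** K p) $ j $ m * J p $ m $ a))"
    by (simp add: R mult_ac)
  also have "\<dots> = (\<Sum>a\<in>UNIV. \<Sum>b\<in>UNIV. \<Sum>m\<in>UNIV. ?J i b * ((J p ** ?R a b p ** K p) $ j $ m * J p $ m $ a))"
    by (rule sum_rotate[symmetric])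
  also have "\<dots> = (\<Sum>a\<in>UNIV. \<Sum>b\<in>UNIV. ?J i b * (J p ** ?R a b p ** K p ** J p) $ j $ a)"
    by (simp only: matrix_matrix_mult_def[of "J p ** ?R _ _ p ** K p"] sum_distrib_left)
      (simp add: sum_distrib_left)
  also have "\<dots> = (\<Sum>a\<in>UNIV. \<Sum>b\<in>UNIV. \<Sum>e\<in>UNIV. ?J i b * (?J j e * curvature \<Gamma> d p a b e a))"
    by (simp add: KJ p flip: matrix_mul_assoc) (simp add: matrix_matrix_mult_def curv_mat_def sum_distrib_left)
  also have "\<dots> = (\<Sum>b\<in>UNIV. \<Sum>e\<in>UNIV. \<Sum>a\<in>UNIV. ?J i b * (?J j e * curvature \<Gamma> d p a b e a))"
    by (rule sum_rotate[symmetric])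
  finally show ?thesis by (simp add: ricci_def sum_distrib_left mult.assoc)
qed

end

section \<open>Passing from charts to the manifold\<close>

text \<open>Preimages of all sets are open, so the level set through \<open>x\<close> is open and
  closed.\<close>

lemma connected_space_locally_constant:
  assumes "connected_space X"
    and loc: "\<And>x. x \<in> topspace X \<Longrightarrow> \<exists>U. openin X U \<and> x \<in> U \<and> (\<forall>y\<in>U. f y = f x)"
    and "x \<in> topspace X" "y \<in> topspace X"
  shows "f y = f x"
proof -
  have op: "openin X {z \<in> topspace X. f z \<in> S}" for S
  proof (subst openin_subopen, intro ballI)
    fix z assume z: "z \<in> {z \<in> topspace X. f z \<in> S}"
    then have "z \<in> topspace X" by simp
    from loc[OF this] obtain U where U: "openin X U" "z \<in> U" "\<And>y. y \<in> U \<Longrightarrow> f y = f z" by blast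
    have "U \<subseteq> {z \<in> topspace X. f z \<in> S}"
    proof
      fix y assume "y \<in> U"
      with U(1) openin_subset have "y \<in> topspace X" by blast
      moreover have "f y \<in> S" using U(3)[OF \<open>y \<in> U\<close>] z by simp
      ultimately show "y \<in> {z \<in> topspace X. f z \<in> S}" by simp
    qed
    with U(1,2) show "\<exists>T. openin X T \<and> z \<in> T \<and> T \<subseteq> {z \<in> topspace X. f z \<in> S}" by blast
  qed
  have "topspace X - {z \<in> topspace X. f z \<in> {f x}} = {z \<in> topspace X. f z \<in> - {f x}}" by auto
  then have "openin X (topspace X - {z \<in> topspace X. f z \<in> {f x}})" using op by (simp only:)
  then have "closedin X {z \<in> topspace X. f z \<in> {f x}}" by (simp add: closedin_def)
  then have "{z \<in> topspace X. f z \<in> {f x}} = {} \<or> {z \<in> topspace X. f z \<in> {f x}} = topspace X"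
    using assms(1) op unfolding connected_space_clopen_in by blast
  then show ?thesis using assms(3,4) by blast
qed

text \<open>In coordinates the derivative vanishes on a ball, which is convex; the preimage of that
  ball is the neighbourhood.\<close>

lemma chart_locally_constant:
  assumes c: "is_chart X c" and p: "p \<in> fst c"
    and diff: "\<And>q. q \<in> fst c \<Longrightarrow> chart_differentiable c f q"
    and zero: "\<And>q i. q \<in> fst c \<Longrightarrow> chart_partial c i f q = 0"
  shows "\<exists>U. openin X U \<and> p \<in> U \<and> U \<subseteq> fst c \<and> (\<forall>q\<in>U. f q = f p)"
proof -
  have op: "openin X (fst c)" using c by (simp add: is_chart_def)
  interpret chart_domain c "fst c" by (rule chart_domainI[OF c op]) simp
  obtain r where r: "r > 0" "ball (snd c p) r \<subseteq> chart_image c"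
    using open_image p open_contains_ball by (metis imageI)
  let ?u = "coord_expr c f"
  have "(?u has_derivative (\<lambda>v. 0)) (at x within ball (snd c p) r)" if x: "x \<in> ball (snd c p) r" for x
  proof -
    obtain q where q: "q \<in> fst c" "x = snd c q" using x r(2) by blast
    then have d: "?u differentiable (at x)" using diff by (simp add: chart_differentiable_def)
    have "partial_deriv i ?u x = 0" for i
      using zero[OF q(1), of i] by (simp add: q chart_partial_def)
    then have "frechet_derivative ?u (at x) = (\<lambda>v. 0)"
      by (simp add: fun_eq_iff frechet_derivative_eq_sum_partial_deriv[OF d])
    then show ?thesis
      using d frechet_derivative_works has_derivative_at_withinI by metis
  qed
  then obtain k where k: "\<And>x. x \<in> ball (snd c p) r \<Longrightarrow> ?u x = k"
    using has_derivative_zero_constant[OF convex_ball] by metis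
  let ?U = "{q \<in> fst c. snd c q \<in> ball (snd c p) r}"
  have top: "topspace (subtopology X (fst c)) = fst c"
    using openin_subset[OF op] by auto
  have "continuous_map (subtopology X (fst c)) (top_of_set (chart_image c)) (snd c)"
    using c homeomorphic_imp_continuous_map unfolding is_chart_def by blast
  moreover have "openin (top_of_set (chart_image c)) (ball (snd c p) r)"
    using r(2) by (simp add: open_subset)
  ultimately have "openin (subtopology X (fst c)) ?U"
    using openin_continuous_map_preimage top by fastforce
  then have "openin X ?U" using op openin_trans_full by blast
  moreover have "f q = f p" if "q \<in> ?U" for q
    using k[of "snd c q"] k[of "snd c p"] that r(1) p by (simp add: coord_expr_apply)
  moreover have "p \<in> ?U" "?U \<subseteq> fst c" using p r(1) by auto
  ultimately show ?thesis by blast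
qed

lemma connection_overlapI:
  assumes X: "smooth_manifold X A" and \<Gamma>: "affine_connection A \<Gamma>" and cd: "c \<in> A" "d \<in> A"
  shows "connection_overlap c d (fst c \<inter> fst d) \<Gamma>"
proof -
  have ch: "is_chart X c" "is_chart X d" using X cd by (auto simp: smooth_manifold_def)
  then have op: "openin X (fst c \<inter> fst d)" by (simp add: is_chart_def openin_Int)
  show ?thesis
  proof (intro connection_overlap.intro chart_overlap.intro connection_overlap_axioms.intro)
    show "chart_domain c (fst c \<inter> fst d)" "chart_domain d (fst c \<inter> fst d)"
      using ch op by (auto intro: chart_domainI)
    show "smooth_on (snd c ` (fst c \<inter> fst d)) (coord_expr c (\<lambda>p. snd d p $ m))" for m
      using X cd by (simp add: smooth_manifold_def)
    show "smooth_on (snd d ` (fst c \<inter> fst d)) (coord_expr d (\<lambda>p. snd c p $ m))" for m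
      using X cd by (simp add: smooth_manifold_def Int_commute[of "fst c"])
  qed (use \<Gamma> cd in \<open>auto simp: affine_connection_def\<close>)
qed

lemma pseudo_riemannian_metricD:
  assumes "pseudo_riemannian_metric A g" "c \<in> A"
  shows "smooth_on (chart_image c) (coord_expr c (\<lambda>p. g c p i j))"
    and "p \<in> fst c \<Longrightarrow> g c p i j = g c p j i"
    and "p \<in> fst c \<Longrightarrow> invertible (\<chi> i j. g c p i j)"
  using assms unfolding pseudo_riemannian_metric_def by blast+

lemma naive_einstein_chartI:
  fixes A :: "('a, 'n::finite) chart set"
  assumes X: "smooth_manifold X A" and ss: "special_statistical A \<Gamma> g"
    and lc: "levi_civita A g D" and ne: "naive_einstein A \<Gamma> g" and c: "c \<in> A"
  shows "naive_einstein_chart c g D \<Gamma>"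
proof -
  have ch: "is_chart X c" using X c by (auto simp: smooth_manifold_def)
  have g: "pseudo_riemannian_metric A g" using ss by (simp add: special_statistical_def)
  interpret chart_domain c "fst c"
    by (rule chart_domainI[OF ch]) (use ch in \<open>auto simp: is_chart_def\<close>)
  show ?thesis
  proof
    show "chart_smooth (\<lambda>p. g c p i j)" for i j
      by (simp add: chart_smooth_def pseudo_riemannian_metricD[OF g c])
    show "g c p i j = g c p j i" "invertible (\<chi> i j. g c p i j)" if "p \<in> fst c" for p i j
      using that by (rule pseudo_riemannian_metricD[OF g c])+
    show "chart_smooth (\<lambda>p. D c p i j k)" for i j k
      using lc c by (simp add: chart_smooth_def levi_civita_def affine_connection_def)
    show "D c p i j k = D c p j i k" "cov_deriv D g c p i j k = 0" if "p \<in> fst c" for p i j k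
      using lc c that by (auto simp: levi_civita_def torsion_free_def)
    show "chart_smooth (\<lambda>p. \<Gamma> c p i j k)" for i j k
      using ss c by (simp add: chart_smooth_def special_statistical_def affine_connection_def)
    show "\<Gamma> c p i j k = \<Gamma> c p j i k" "cubic_form \<Gamma> g c p i j k = cubic_form \<Gamma> g c p j i k"
      if "p \<in> fst c" for p i j k
      using ss c that unfolding special_statistical_def torsion_free_def cubic_form_def by simp_all
    show "(\<Sum>a\<in>UNIV. \<Sum>b\<in>UNIV. ginv g c p a b * cubic_form \<Gamma> g c p i a b) = 0" if "p \<in> fst c" for p i
      using ss c that unfolding special_statistical_def cubic_form_def by blast
    show "(1/2) * (ricci \<Gamma> c p i j + ricci \<Gamma> c p j i) = scalar_curvature g \<Gamma> c p / real CARD('n) * g c p i j"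
      "(1/2) * (ricci (conjugate \<Gamma> g) c p i j + ricci (conjugate \<Gamma> g) c p j i)
        = scalar_curvature g \<Gamma> c p / real CARD('n) * g c p i j" if "p \<in> fst c" for p i j
      using ne c that by (simp_all add: naive_einstein_def)
  qed
qed

text \<open>The symmetrized Ricci tensor is \<open>g\<close> times s/n in either chart. Both tensors
  transform alike, so the two factors multiply the same components of \<open>g\<close>, one of which
  is nonzero.\<close>

lemma scalar_curvature_chart_independent:
  fixes A :: "('a, 'n::finite) chart set"
  assumes X: "smooth_manifold X A" and ss: "special_statistical A \<Gamma> g" and ne: "naive_einstein A \<Gamma> g"
    and cd: "c \<in> A" "d \<in> A" and p: "p \<in> fst c" "p \<in> fst d"
  shows "scalar_curvature g \<Gamma> c p = scalar_curvature g \<Gamma> d p"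
proof -
  interpret connection_overlap c d "fst c \<inter> fst d" \<Gamma>
    using ss by (intro connection_overlapI[OF X _ cd]) (simp add: special_statistical_def)
  let ?J = "jacobian c d p" and ?n = "real CARD('n)"
  have pV: "p \<in> fst c \<inter> fst d" using p by simp
  have g: "g c p i j = (\<Sum>a\<in>UNIV. \<Sum>b\<in>UNIV. ?J i a * ?J j b * g d p a b)" for i j
    using ss cd pV unfolding special_statistical_def pseudo_riemannian_metric_def by blast
  have eq: "scalar_curvature g \<Gamma> c p / ?n * g c p i j = scalar_curvature g \<Gamma> d p / ?n * g c p i j" for i j
  proof -
    have "ricci \<Gamma> c p j i = (\<Sum>a\<in>UNIV. \<Sum>b\<in>UNIV. ?J i a * ?J j b * ricci \<Gamma> d p b a)"
      unfolding ricci_transform[OF pV, of j i] by (subst sum.swap) (simp add: mult.commute)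
    then have "(1/2) * (ricci \<Gamma> c p i j + ricci \<Gamma> c p j i)
        = (\<Sum>a\<in>UNIV. \<Sum>b\<in>UNIV. ?J i a * ?J j b * ((1/2) * (ricci \<Gamma> d p a b + ricci \<Gamma> d p b a)))"
      unfolding ricci_transform[OF pV, of i j]
      by (simp add: sum_distrib_left sum.distrib distrib_left mult_ac)
    also have "\<dots> = (\<Sum>a\<in>UNIV. \<Sum>b\<in>UNIV. ?J i a * ?J j b * (scalar_curvature g \<Gamma> d p / ?n * g d p a b))"
      using ne cd(2) p(2) unfolding naive_einstein_def by simp
    also have "\<dots> = scalar_curvature g \<Gamma> d p / ?n * g c p i j"
      unfolding g by (simp add: sum_distrib_left mult_ac)
    finally show ?thesis using ne cd(1) p(1) unfolding naive_einstein_def by simp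
  qed
  have "invertible (\<chi> i j. g c p i j)"
    using ss by (intro pseudo_riemannian_metricD(3)[OF _ cd(1) p(1)]) (simp add: special_statistical_def)
  then obtain i j where "g c p i j \<noteq> 0" using invertible_imp_nonzero_entry by fastforce
  with eq[of i j] show ?thesis by simp
qed

lemma einstein_imp_scalar_curvature_constant:
  assumes X: "smooth_manifold X A" and ss: "special_statistical A \<Gamma> g"
    and lc: "levi_civita A g D" and ein: "einstein A \<Gamma> g"
  shows "\<exists>k. \<forall>c\<in>A. \<forall>p\<in>fst c. scalar_curvature g \<Gamma> c p = k"
proof -
  have ne: "naive_einstein A \<Gamma> g" using ein by (simp add: einstein_def)
  \<comment> \<open>The scalar curvature is given chart by chart; an arbitrary choice of a chart
    around each point makes it a function on the manifold, well defined by chart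
    independence.\<close>
  define f where "f p = scalar_curvature g \<Gamma> (SOME c. c \<in> A \<and> p \<in> fst c) p" for p
  have f: "f p = scalar_curvature g \<Gamma> c p" if "c \<in> A" "p \<in> fst c" for c p
  proof -
    have "(SOME c. c \<in> A \<and> p \<in> fst c) \<in> A \<and> p \<in> fst (SOME c. c \<in> A \<and> p \<in> fst c)"
      by (rule someI[of _ c]) (use that in simp)
    then show ?thesis
      unfolding f_def using that by (intro scalar_curvature_chart_independent[OF X ss ne]) auto
  qed
  have "\<exists>U. openin X U \<and> p \<in> U \<and> (\<forall>q\<in>U. f q = f p)" if "p \<in> topspace X" for p
  proof -
    have "p \<in> (\<Union>c\<in>A. fst c)" using X that by (simp add: smooth_manifold_def)
    then obtain c where c: "c \<in> A" "p \<in> fst c" by blast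
    interpret naive_einstein_chart c g D \<Gamma> by (rule naive_einstein_chartI[OF X ss lc ne c(1)])
    have ch: "is_chart X c" using X c by (simp add: smooth_manifold_def)
    have zero: "chart_partial c i s q = 0" if "q \<in> fst c" for i q
      using ein c that by (simp add: einstein_def d_scalar_def)
    obtain U where U: "openin X U" "p \<in> U" "U \<subseteq> fst c" "\<forall>q\<in>U. s q = s p"
      using chart_locally_constant[OF ch c(2) s_differentiable zero] by blast
    have "f q = f p" if "q \<in> U" for q
      using U that f[OF c(1)] c(2) by (metis subsetD)
    with U(1,2) show ?thesis by blast
  qed
  then have const: "f q = f p" if "p \<in> topspace X" "q \<in> topspace X" for p q
    using connected_space_locally_constant[of X f p q] X that by (simp add: smooth_manifold_def)
  have top: "p \<in> topspace X" if "c \<in> A" "p \<in> fst c" for c p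
    using X that by (auto simp: smooth_manifold_def)
  show ?thesis
  \<comment> \<open>The definition of a manifold admits the empty space, where there is no point to
    take the value from.\<close>
  proof (cases "topspace X = {}")
    case True
    then show ?thesis using top by blast
  next
    case False
    then obtain p where "p \<in> topspace X" by blast
    then show ?thesis using const f top by metis
  qed
qed

text \<open>A cosmological constant appears because \<open>einstein_tensor_eq\<close> leaves a
  multiple of \<open>g\<close> which, in dimension at least 3, vanishes exactly where the scalar
  curvature does: a round sphere with zero cubic form is Einstein, yet its Einstein tensor is not
  zero. The last clause describes the equations with constant 0. The naive Einstein condition
  governs the first chain of equalities as well: for zero cubic form its last two members vanish,
  while the first contains the differential of the scalar curvature of \<open>g\<close>.\<close>

theorem corollary9p20:
  fixes X :: "'a topology"
    and A :: "('a, 'n::finite) chart set"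
    and \<Gamma> D :: "('a, 'n) comp3"
    and g :: "('a, 'n) comp2"
  assumes "smooth_manifold X A"
    and "special_statistical A \<Gamma> g"
    and "levi_civita A g D"
    and "naive_einstein A \<Gamma> g"
  shows "(\<forall>c\<in>A. \<forall>p\<in>fst c. \<forall>i.
            2 * (real CARD('n) - 2) * d_scalar g \<Gamma> c p i
              = 2 * real CARD('n) * cubic_form_dot_curvature \<Gamma> g c p i \<and>
            2 * real CARD('n) * cubic_form_dot_curvature \<Gamma> g c p i
              = real CARD('n) * divergence g D (stress_energy \<Gamma> g) c p i) \<and>
         (CARD('n) \<ge> 3 \<longrightarrow>
            (einstein A \<Gamma> g \<longleftrightarrow>
              (\<forall>c\<in>A. \<forall>p\<in>fst c. \<forall>i. divergence g D (stress_energy \<Gamma> g) c p i = 0)) \<and>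
            (einstein A \<Gamma> g \<longleftrightarrow>
              (\<exists>\<Lambda>. einstein_field_equations A g D \<Lambda> (stress_energy \<Gamma> g))) \<and>
            (einstein_field_equations A g D 0 (stress_energy \<Gamma> g) \<longleftrightarrow>
              einstein A \<Gamma> g \<and> (\<forall>c\<in>A. \<forall>p\<in>fst c. scalar_curvature g \<Gamma> c p = 0)))"
proof -
  let ?n = "real CARD('n)" and ?T = "stress_energy \<Gamma> g" and ?s = "scalar_curvature g \<Gamma>"
  note chart = naive_einstein_chartI[OF assms]
  have div: "?n * divergence g D ?T c p i = 2 * (?n - 2) * d_scalar g \<Gamma> c p i"
    and dot: "divergence g D ?T c p i = 2 * cubic_form_dot_curvature \<Gamma> g c p i"
    if "c \<in> A" "p \<in> fst c" for c p i
    using naive_einstein_chart.divergence_stress_energy[OF chart]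
      naive_einstein_chart.divergence_stress_energy_eq_dot_curvature[OF chart] that by blast+
  \<comment> \<open>By \<open>einstein_tensor_eq\<close> the equations compare two multiples of
    \<open>g\<close>; a nonzero component reduces them to one scalar equation at each point.\<close>
  have efe: "einstein_field_equations A g D \<Lambda> ?T \<longleftrightarrow> (\<forall>c\<in>A. \<forall>p\<in>fst c. \<Lambda> = (?n - 2) / (2 * ?n) * ?s c p)" for \<Lambda>
  proof -
    have "(\<forall>i j. einstein_tensor g D c p i j + \<Lambda> * g c p i j = (1/4) * ?T c p i j)
        \<longleftrightarrow> \<Lambda> = (?n - 2) / (2 * ?n) * ?s c p" if c: "c \<in> A" and p: "p \<in> fst c" for c p
    proof -
      interpret naive_einstein_chart c g D \<Gamma> by (rule chart[OF c])
      obtain i j where g: "g c p i j \<noteq> 0"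
        using invertible_imp_nonzero_entry[OF g_invertible[OF p]] by auto
      have "einstein_tensor g D c p i j + \<Lambda> * g c p i j = (1/4) * ?T c p i j
          \<longleftrightarrow> \<Lambda> * g c p i j = (?n - 2) / (2 * ?n) * ?s c p * g c p i j" for i j
        unfolding einstein_tensor_eq[OF p] by linarith
      then show ?thesis using g by (metis mult_cancel_right)
    qed
    then show ?thesis unfolding einstein_field_equations_def by blast
  qed
  have ein: "einstein A \<Gamma> g \<longleftrightarrow> (\<forall>c\<in>A. \<forall>p\<in>fst c. \<forall>i. d_scalar g \<Gamma> c p i = 0)"
    using assms(4) by (simp add: einstein_def)
  have const: "einstein A \<Gamma> g" if k: "\<forall>c\<in>A. \<forall>p\<in>fst c. ?s c p = k" for k
    unfolding ein
  proof (intro ballI allI)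
    fix c p i assume c: "c \<in> A" and p: "p \<in> fst c"
    interpret naive_einstein_chart c g D \<Gamma> by (rule chart[OF c])
    have "chart_partial c i (?s c) p = chart_partial c i (\<lambda>q. k) p"
      by (rule chart_partial_cong[OF p]) (use k c in simp)
    then show "d_scalar g \<Gamma> c p i = 0" by (simp add: d_scalar_def)
  qed
  have n3: "(einstein A \<Gamma> g \<longleftrightarrow> (\<forall>c\<in>A. \<forall>p\<in>fst c. \<forall>i. divergence g D ?T c p i = 0)) \<and>
      (einstein A \<Gamma> g \<longleftrightarrow> (\<exists>\<Lambda>. einstein_field_equations A g D \<Lambda> ?T)) \<and>
      (einstein_field_equations A g D 0 ?T \<longleftrightarrow>
        einstein A \<Gamma> g \<and> (\<forall>c\<in>A. \<forall>p\<in>fst c. ?s c p = 0))" if "CARD('n) \<ge> 3"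
  proof (intro conjI)
    have n: "?n - 2 > 0" "?n > 0" using that by simp_all
    have "divergence g D ?T c p i = 0 \<longleftrightarrow> d_scalar g \<Gamma> c p i = 0" if "c \<in> A" "p \<in> fst c" for c p i
      using div[OF that, of i] n by (metis less_numeral_extra(3) mult_eq_0_iff zero_neq_numeral)
    then show "einstein A \<Gamma> g \<longleftrightarrow> (\<forall>c\<in>A. \<forall>p\<in>fst c. \<forall>i. divergence g D ?T c p i = 0)"
      unfolding ein by blast
    show "einstein A \<Gamma> g \<longleftrightarrow> (\<exists>\<Lambda>. einstein_field_equations A g D \<Lambda> ?T)"
    proof
      assume "einstein A \<Gamma> g"
      \<comment> \<open>One constant has to serve all charts, so the vanishing of the differential
        must first be turned into global constancy.\<close>
      from einstein_imp_scalar_curvature_constant[OF assms(1-3) this]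
      show "\<exists>\<Lambda>. einstein_field_equations A g D \<Lambda> ?T" unfolding efe by metis
    next
      assume "\<exists>\<Lambda>. einstein_field_equations A g D \<Lambda> ?T"
      then obtain \<Lambda> where "\<forall>c\<in>A. \<forall>p\<in>fst c. \<Lambda> = (?n - 2) / (2 * ?n) * ?s c p"
        unfolding efe by blast
      \<comment> \<open>Dimension at least 3 makes the factor n - 2 invertible.\<close>
      then have "\<forall>c\<in>A. \<forall>p\<in>fst c. ?s c p = \<Lambda> * (2 * ?n) / (?n - 2)"
        using n by (auto simp: field_simps)
      then show "einstein A \<Gamma> g" by (rule const)
    qed
    show "einstein_field_equations A g D 0 ?T \<longleftrightarrow> einstein A \<Gamma> g \<and> (\<forall>c\<in>A. \<forall>p\<in>fst c. ?s c p = 0)"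
      using n const[of 0] unfolding efe by auto
  qed
  have "2 * (?n - 2) * d_scalar g \<Gamma> c p i = 2 * ?n * cubic_form_dot_curvature \<Gamma> g c p i \<and>
      2 * ?n * cubic_form_dot_curvature \<Gamma> g c p i = ?n * divergence g D ?T c p i"
    if "c \<in> A" "p \<in> fst c" for c p i
    using div[OF that, of i] dot[OF that, of i] by simp
  with n3 show ?thesis by blast
qed

end
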